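(* Let $p$ be a prime, $m\ge 1$ an integer, $0<\varepsilon<1$, and let $f_0,\ldots,f_m\in\mathbb{F}_p[X_0,\ldots,X_m]$ be of total degree $d\ge2$ and of the form $$f_i=X_i\,g_i(X_{i+1},\ldots,X_m)+h_i(X_{i+1},\ldots,X_m),\quad i=0,\ldots,m-1,\qquad f_m=aX_m+b,$$ where $a,b\in\mathbb{F}_p$, $a\neq 0$, $g_i,h_i\in\mathbb{F}_p[X_{i+1},\ldots,X_m]$, and for each $i=0,\ldots,m-1$ there are nonnegative integers $s_{i,i+1},\ldots,s_{i,m}$ with $$g_i=X_{i+1}^{s_{i,i+1}}\cdots X_m^{s_{i,m}}+\widetilde{g_i}(X_{i+1},\ldots,X_m),\qquad \deg_{X_j}\widetilde{g_i}<s_{i,j},\qquad \deg_{X_j}h_i\le s_{i,j}\quad(j=i+1,\ldots,m),$$ and such that $s_{0,1}s_{1,2}\cdots s_{m-1,m}\neq0$. Assume $\{f_0,\ldots,f_m\}$ is a permutation polynomial system, i.e. $\vec v\mapsto(f_0(\vec v),\ldots,f_m(\vec v))$ is a bijection of $\mathbb{F}_p^{m+1}$. For an initial value $\vec v\in\mathbb{F}_p^{m+1}$ define $(u_{0,0},\ldots,u_{0,m})=\vec v$ and $u_{n+1,i}\equiv f_i(u_{n,0},\ldots,u_{n,m})\pmod p$ for $n\ge0$, $i=0,\ldots,m$, with $0\le u_{n,i}<p$. Let $D_N(\vec v)$ be the discrepancy of the $N$ points $$\left(\frac{u_{n,0}}{p},\ldots,\frac{u_{n,m-1}}{p}\right),\qquad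 n=0,\ldots,N-1,$$ in $[0,1)^m$. Then for all $\vec v\in\mathbb{F}_p^{m+1}$ except at most $O(\varepsilon p^{m+1})$ of them, and every positive integer $N\le p^{m+1}$, $$D_N(\vec v)\ll \varepsilon^{-1}B(N,p),\qquad B(N,p)=\begin{cases}N^{-1/2}(\log N)^{m+1}\log p, & N\le p^{1/(m+1)},\\ p^{-1/(2(m+1))}(\log N)^{m+1}\log p, & N>p^{1/(m+1)},\end{cases}$$ where the implied constants do not depend on $p$, $N$, $\varepsilon$ or $\vec v$.
   Context: The discrepancy of a sequence $\Gamma$ of $N$ points in $[0,1)^s$ is $\sup_B\left|T_\Gamma(B)/N-|B|\right|$, where the supremum is over all boxes $B=[\alpha_1,\beta_1)\times\cdots\times[\alpha_s,\beta_s)\subseteq[0,1)^s$, $|B|$ is the volume of $B$ and $T_\Gamma(B)$ is the number of points of $\Gamma$ in $B$. $\deg_{X_j}$ is the degree in $X_j$. $A\ll B$ and $A=O(B)$ mean $|A|\le cB$ for some constant $c>0$.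
   Formalization: The bound is stated for 2 ≤ N ≤ p^{m+1} instead of every positive N: at N = 1 the factor (log N)^{m+1} makes B(1,p) = 0, while the discrepancy of one point is positive, so the claim as printed is false there. *)

theory Defs
  imports Complex_Main "HOL-Library.FuncSet" "HOL-Library.Poly_Mapping" "HOL-Number_Theory.Cong"
begin

(* Polynomials in the indeterminates X_0, X_1, ...: a finitely supported map from exponent
   vectors to coefficients.  An element of F_p[X_j : j in V] is represented by the unique such
   polynomial whose coefficients lie in {0..<p}; identities between elements of F_p[...] are
   coefficientwise congruences mod p. *)

type_synonym mpoly = "(nat \<Rightarrow>\<^sub>0 nat) \<Rightarrow>\<^sub>0 int"

definition Var :: "nat \<Rightarrow> mpoly" where
  "Var j = Poly_Mapping.single (Poly_Mapping.single j 1) 1"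

definition Const :: "int \<Rightarrow> mpoly" where
  "Const a = Poly_Mapping.single 0 a"

definition Fp_polys :: "nat \<Rightarrow> nat set \<Rightarrow> mpoly set" where
  "Fp_polys p V =
     {P. \<forall>t \<in> Poly_Mapping.keys P.
           Poly_Mapping.lookup P t \<in> {0..<int p} \<and> Poly_Mapping.keys t \<subseteq> V}"

definition Fp_eq :: "nat \<Rightarrow> mpoly \<Rightarrow> mpoly \<Rightarrow> bool" where
  "Fp_eq p P Q \<longleftrightarrow> (\<forall>t. [Poly_Mapping.lookup P t = Poly_Mapping.lookup Q t] (mod int p))"

definition mp_eval :: "mpoly \<Rightarrow> (nat \<Rightarrow> int) \<Rightarrow> int" where
  "mp_eval P x =
     (\<Sum>t \<in> Poly_Mapping.keys P.
        Poly_Mapping.lookup P t * (\<Prod>j \<in> Poly_Mapping.keys t. x j ^ Poly_Mapping.lookup t j))"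

(* Both degrees take the value -1 at the zero polynomial.  This plays the role of minus infinity:
   the degree of 0 is smaller than every natural number, including 0. *)

definition deg_in :: "nat \<Rightarrow> mpoly \<Rightarrow> int" where
  "deg_in j P = Max (insert (-1) ((\<lambda>t. int (Poly_Mapping.lookup t j)) ` Poly_Mapping.keys P))"

definition total_deg :: "mpoly \<Rightarrow> int" where
  "total_deg P =
     Max (insert (-1) ((\<lambda>t. int (\<Sum>j \<in> Poly_Mapping.keys t. Poly_Mapping.lookup t j))
       ` Poly_Mapping.keys P))"

definition triangular_system :: "nat \<Rightarrow> nat \<Rightarrow> (nat \<Rightarrow> mpoly) \<Rightarrow> bool" where
  "triangular_system p m f \<longleftrightarrow>
     (\<forall>i\<le>m. f i \<in> Fp_polys p {..m}) \<and>
     (\<exists>a\<in>{0..<int p}. \<exists>b\<in>{0..<int p}. a \<noteq> 0 \<and> Fp_eq p (f m) (Const a * Var m + Const b)) \<and>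
     (\<exists>s :: nat \<Rightarrow> nat \<Rightarrow> nat.
        (\<Prod>i<m. s i (i + 1)) \<noteq> 0 \<and>
        (\<forall>i<m. \<exists>g \<in> Fp_polys p {i<..m}. \<exists>h \<in> Fp_polys p {i<..m}. \<exists>g' \<in> Fp_polys p {i<..m}.
           Fp_eq p (f i) (Var i * g + h) \<and>
           Fp_eq p g ((\<Prod>j\<in>{i<..m}. Var j ^ s i j) + g') \<and>
           (\<forall>j\<in>{i<..m}. deg_in j g' < int (s i j) \<and> deg_in j h \<le> int (s i j))))"

definition system_deg :: "nat \<Rightarrow> (nat \<Rightarrow> mpoly) \<Rightarrow> int" where
  "system_deg m f = Max ((\<lambda>i. total_deg (f i)) ` {..m})"

(* F_p^(m+1), with F_p identified with {0..<p} *)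
definition Fp_vecs :: "nat \<Rightarrow> nat \<Rightarrow> (nat \<Rightarrow> int) set" where
  "Fp_vecs p m = (\<Pi>\<^sub>E i\<in>{..m}. {0..<int p})"

definition system_map :: "nat \<Rightarrow> nat \<Rightarrow> (nat \<Rightarrow> mpoly) \<Rightarrow> (nat \<Rightarrow> int) \<Rightarrow> nat \<Rightarrow> int" where
  "system_map p m f v = (\<lambda>i\<in>{..m}. mp_eval (f i) v mod int p)"

definition permutation_system :: "nat \<Rightarrow> nat \<Rightarrow> (nat \<Rightarrow> mpoly) \<Rightarrow> bool" where
  "permutation_system p m f \<longleftrightarrow> bij_betw (system_map p m f) (Fp_vecs p m) (Fp_vecs p m)"

primrec gen_seq ::
  "nat \<Rightarrow> nat \<Rightarrow> (nat \<Rightarrow> mpoly) \<Rightarrow> (nat \<Rightarrow> int) \<Rightarrow> nat \<Rightarrow> nat \<Rightarrow> int" where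
  "gen_seq p m f v 0 = v"
| "gen_seq p m f v (Suc n) = system_map p m f (gen_seq p m f v n)"

(* Discrepancy of the first N terms of x in [0,1)^s; x n j is coordinate j < s of the n-th point.
   Points are counted with multiplicity. *)
definition discrepancy :: "nat \<Rightarrow> (nat \<Rightarrow> nat \<Rightarrow> real) \<Rightarrow> nat \<Rightarrow> real" where
  "discrepancy s x N =
     (SUP (\<alpha>, \<beta>) \<in> {(\<alpha>, \<beta>). \<forall>j<s. 0 \<le> \<alpha> j \<and> \<alpha> j \<le> \<beta> j \<and> \<beta> j \<le> 1}.
        \<bar>real (card {n. n < N \<and> (\<forall>j<s. \<alpha> j \<le> x n j \<and> x n j < \<beta> j)}) / real N
          - (\<Prod>j<s. \<beta> j - \<alpha> j)\<bar>)"

(* Only the coordinates u_{n,0}, ..., u_{n,m-1} enter; the last one is discarded. *)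
definition gen_discrepancy :: "nat \<Rightarrow> nat \<Rightarrow> (nat \<Rightarrow> mpoly) \<Rightarrow> (nat \<Rightarrow> int) \<Rightarrow> nat \<Rightarrow> real" where
  "gen_discrepancy p m f v N =
     discrepancy m (\<lambda>n j. real_of_int (gen_seq p m f v n j) / real p) N"

(* Vanishes at N = 1, where the discrepancy is positive; it is a meaningful bound only for N >= 2. *)
definition B_bound :: "nat \<Rightarrow> nat \<Rightarrow> nat \<Rightarrow> real" where
  "B_bound m N p =
     (if real N \<le> real p powr (1 / real (m + 1))
      then real N powr (- 1 / 2) * ln (real N) ^ (m + 1) * ln (real p)
      else real p powr (- 1 / (2 * real (m + 1))) * ln (real N) ^ (m + 1) * ln (real p))"

end

theory Submission
  imports Defs "HOL-Analysis.Analysis" "HOL-Computational_Algebra.Polynomial"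
begin

text \<open>
  Write \<open>F\<close> for the system map, a bijection of \<open>V = F_p^(m+1)\<close>, and let \<open>a\<close> be a nonzero frequency
  vector whose first nonzero entry is at \<open>i\<close>. The coordinate \<open>i\<close> of the \<open>k\<close>-th iterate is
  \<open>w i * G i k w + K i k w\<close> with \<open>G\<close>, \<open>K\<close> depending on later coordinates only, so summing
  \<open>e_p(a \<bullet> (F^k w - w))\<close> over \<open>w i\<close> first leaves the points with \<open>G i k w = 1\<close>. Here
  \<open>G i k w\<close> is the product of the values of \<open>g_i\<close> along the orbit. Unless one of the coordinates
  \<open>> i + 1\<close> vanishes somewhere on the orbit, which by bijectivity happens for \<open>O(k p^m)\<close> points, it is
  a polynomial in \<open>w (i + 1)\<close> of degree between \<open>1\<close> and \<open>k d\<close> with nonzero leading coefficient.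
  Hence the sum is \<open>O(k p^m)\<close>.

  Expanding the square and averaging over the initial value, exponential sums over \<open>L\<close> consecutive
  points have mean square \<open>O(L + L^2 / sqrt p)\<close>; a dyadic decomposition (Rademacher--Menshov) makes
  this uniform over all initial segments shorter than \<open>2^J\<close> at the cost of a factor \<open>J\<close>.
  The discrepancy is bounded by these sums through trapezoidal majorants and minorants of boxes, whose
  Fourier coefficients sum to \<open>O(J^m)\<close>. Markov's inequality gives for each of the \<open>O(log p)\<close>
  values of \<open>J\<close> at most \<open>\<epsilon> p^(m+1) / log p\<close> exceptional initial values.
\<close>


section \<open>Additive characters modulo \<open>p\<close>\<close>

definition ep :: "nat \<Rightarrow> int \<Rightarrow> complex" where
  "ep p x = cis (2 * pi * real_of_int x / real p)"

text \<open>This is p times the distance from a/p to the nearest integer, the quantity that governs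
  the size of geometric sums of \<open>ep\<close>.\<close>

definition circle_dist :: "nat \<Rightarrow> int \<Rightarrow> int" where
  "circle_dist p a = min (a mod int p) (int p - a mod int p)"

lemma norm_ep [simp]: "cmod (ep p x) = 1"
  by (simp add: ep_def)

lemma ep_0 [simp]: "ep p 0 = 1"
  by (simp add: ep_def)

lemma ep_add: "ep p (x + y) = ep p x * ep p y"
  by (simp add: ep_def cis_mult add_divide_distrib ring_distribs)

lemma ep_minus: "ep p (- x) = cnj (ep p x)"
  by (simp add: ep_def cis_cnj)

lemma ep_diff: "ep p (x - y) = ep p x * cnj (ep p y)"
  using ep_add[of p x "- y"] by (simp add: ep_minus)

lemma ep_sum: "finite I \<Longrightarrow> ep p (\<Sum>i\<in>I. x i) = (\<Prod>i\<in>I. ep p (x i))"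
  by (induction I rule: finite_induct) (simp_all add: ep_add)

lemma ep_eq_1:
  assumes "p > 0" "int p dvd x"
  shows "ep p x = 1"
proof -
  from assms obtain k where "x = int p * k" by blast
  then have "2 * pi * real_of_int x / real p = 2 * pi * real_of_int k"
    using assms by simp
  then have "ep p x = cis (2 * pi * real_of_int k)"
    by (simp only: ep_def)
  then show ?thesis by (simp only: cis_multiple_2pi Ints_of_int)
qed

lemma ep_cong:
  assumes "p > 0" "[x = y] (mod int p)"
  shows "ep p x = ep p y"
proof -
  have "ep p (y + (x - y)) = ep p y * ep p (x - y)" by (rule ep_add)
  moreover have "ep p (x - y) = 1"
    using assms by (intro ep_eq_1) (auto simp: cong_iff_dvd_diff)
  ultimately show ?thesis by simp
qed

lemma norm_cis_minus_one: "cmod (cis t - 1) = 2 * \<bar>sin (t / 2)\<bar>"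
proof -
  have "(cmod (cis t - 1))\<^sup>2 = (cos t - 1)\<^sup>2 + (sin t)\<^sup>2"
    by (simp add: cmod_power2)
  also have "\<dots> = 2 - 2 * cos (2 * (t / 2))"
    using sin_cos_squared_add[of t] by (simp add: power2_eq_square algebra_simps)
  also have "\<dots> = (2 * \<bar>sin (t / 2)\<bar>)\<^sup>2"
    by (subst cos_double_sin) (simp add: power_mult_distrib)
  finally show ?thesis
    by (rule power2_eq_imp_eq) auto
qed

text \<open>Third-order Taylor: sin x >= x - x^3/6, and x^2 <= 4 on this range, which contains
  [0, pi/2].\<close>

lemma sin_ge_third:
  fixes x :: real
  assumes "0 \<le> x" "x \<le> 2"
  shows "x / 3 \<le> sin x"
proof -
  have "\<bar>sin x - (\<Sum>i<3. sin_coeff i * x ^ i)\<bar> \<le> inverse (fact 3) * \<bar>x\<bar> ^ 3"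
    by (rule Maclaurin_sin_bound)
  moreover have "(\<Sum>i<3. sin_coeff i * x ^ i) = x"
    by (simp add: numeral_3_eq_3 sin_coeff_def)
  moreover have "x ^ 3 \<le> 4 * x"
  proof -
    have "x * (x * x) \<le> x * (2 * 2)"
      using assms by (intro mult_left_mono mult_mono) auto
    then show ?thesis by (simp add: power3_eq_cube)
  qed
  moreover have "inverse (fact 3) * \<bar>x\<bar> ^ 3 = x ^ 3 / 6"
    using assms by (simp add: fact_numeral field_simps)
  ultimately show ?thesis by linarith
qed

lemma circle_dist_pos:
  assumes "p > 0" "\<not> int p dvd a"
  shows "circle_dist p a > 0"
proof -
  have "0 \<le> a mod int p" "a mod int p < int p" "a mod int p \<noteq> 0"
    using assms by (auto simp: dvd_eq_mod_eq_0)
  then show ?thesis by (simp add: circle_dist_def)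
qed

text \<open>The chord from 1 to \<open>ep p a\<close> has length 2 |sin(pi r/p)|. Reflecting the
  angle at pi/2 brings it to pi/p times the circular distance, which is at most pi/2; there sine is
  at least a third of its argument, and 2 pi/3 >= 1.\<close>

lemma norm_ep_minus_one_ge:
  assumes "p > 0"
  shows "real_of_int (circle_dist p a) / real p \<le> cmod (ep p a - 1)"
proof -
  define r where "r = a mod int p"
  have r: "0 \<le> r" "r < int p" using assms by (auto simp: r_def)
  have *: "\<bar>sin (pi * real_of_int r / real p)\<bar> \<ge> pi * real_of_int (circle_dist p a) / real p / 3"
  proof -
    define y where "y = pi * real_of_int (circle_dist p a) / real p"
    have "circle_dist p a \<le> r" "circle_dist p a \<le> int p - r"
      by (simp_all add: circle_dist_def r_def)
    moreover have "0 \<le> circle_dist p a"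
      using r by (simp add: circle_dist_def r_def)
    ultimately have d: "0 \<le> circle_dist p a" "2 * circle_dist p a \<le> int p" by linarith+
    have "y \<le> pi / 2"
    proof -
      have "real_of_int (2 * circle_dist p a) \<le> real p"
        using d(2) by linarith
      then have "pi * (2 * real_of_int (circle_dist p a)) \<le> pi * real p"
        by (intro mult_left_mono) auto
      then show ?thesis using assms by (simp add: y_def field_simps)
    qed
    then have "y \<le> 2" using pi_less_4 by linarith
    moreover have "0 \<le> y" using d(1) by (simp add: y_def)
    ultimately have "y / 3 \<le> sin y" by (intro sin_ge_third)
    moreover have "sin y = sin (pi * real_of_int r / real p)"
    proof (cases "circle_dist p a = r")
      case False
      then have "circle_dist p a = int p - r" by (auto simp: circle_dist_def r_def min_def split: if_splits)
      then have "y = pi - pi * real_of_int r / real p"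
        using assms by (simp add: y_def diff_divide_distrib right_diff_distrib)
      then show ?thesis by simp
    qed (simp add: y_def)
    ultimately show ?thesis by (simp add: y_def)
  qed
  have "ep p a = ep p r"
    using assms by (intro ep_cong) (auto simp: r_def Cong.cong_def)
  then have "cmod (ep p a - 1) = 2 * \<bar>sin (pi * real_of_int r / real p)\<bar>"
    using norm_cis_minus_one[of "2 * pi * real_of_int r / real p"] by (simp add: ep_def)
  moreover have "real_of_int (circle_dist p a) / real p \<le> 2 * (pi * real_of_int (circle_dist p a) / real p / 3)"
  proof -
    have "0 \<le> circle_dist p a" using r by (auto simp: circle_dist_def r_def)
    then have "3 * real_of_int (circle_dist p a) \<le> (2 * pi) * real_of_int (circle_dist p a)"
      using pi_ge_two by (intro mult_right_mono) auto
    then show ?thesis using assms by (simp add: field_simps)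
  qed
  ultimately show ?thesis using * by linarith
qed

text \<open>Telescoping geometric sum; the factor \<open>ep p a - 1\<close> stays on the left, so
  that the identity also covers p | a.\<close>

lemma sum_ep_interval:
  assumes "A \<le> B"
  shows "(\<Sum>y\<in>{A..<B}. ep p (a * y)) * (ep p a - 1) = ep p (a * B) - ep p (a * A)"
  using assms
proof (induction B rule: int_ge_induct)
  case (step B)
  then have "{A..<B + 1} = insert B {A..<B}" by auto
  then have "(\<Sum>y\<in>{A..<B + 1}. ep p (a * y)) * (ep p a - 1) =
      ep p (a * B) * (ep p a - 1) + (\<Sum>y\<in>{A..<B}. ep p (a * y)) * (ep p a - 1)"
    by (simp add: ring_distribs)
  then show ?case
    unfolding step.IH by (simp add: ring_distribs ep_add)
qed simp

lemma norm_sum_ep_interval_le: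
  assumes "p > 0" "\<not> int p dvd a"
  shows "cmod (\<Sum>y\<in>{A..<B}. ep p (a * y)) \<le> 2 * real p / real_of_int (circle_dist p a)"
proof (cases "A \<le> B")
  case True
  define S where "S = (\<Sum>y\<in>{A..<B}. ep p (a * y))"
  have "cmod S * (real_of_int (circle_dist p a) / real p) \<le> cmod S * cmod (ep p a - 1)"
    using norm_ep_minus_one_ge assms by (intro mult_left_mono) auto
  also have "\<dots> = cmod (ep p (a * B) - ep p (a * A))"
    by (simp add: S_def sum_ep_interval[OF True, symmetric] norm_mult)
  also have "\<dots> \<le> 2"
    using norm_triangle_ineq4[of "ep p (a * B)" "ep p (a * A)"] by simp
  finally show ?thesis
    using circle_dist_pos[OF assms] assms(1) by (simp add: S_def field_simps)
qed (use circle_dist_pos[OF assms] in simp)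

lemma sum_ep_complete:
  assumes "p > 0"
  shows "(\<Sum>y\<in>{0..<int p}. ep p (a * y)) = (if int p dvd a then of_nat p else 0)"
proof (cases "int p dvd a")
  case True
  then show ?thesis using assms by (simp add: ep_eq_1)
next
  case False
  have "0 < cmod (ep p a - 1)"
    using norm_ep_minus_one_ge[OF assms, of a] circle_dist_pos[OF assms False] assms
    by (smt (verit) divide_pos_pos of_int_0_less_iff of_nat_0_less_iff)
  then have "ep p a - 1 \<noteq> 0" by auto
  moreover have "(\<Sum>y\<in>{0..<int p}. ep p (a * y)) * (ep p a - 1) = 0"
    using sum_ep_interval[of 0 "int p" p a] assms by (simp add: ep_eq_1)
  ultimately show ?thesis using False by simp
qed

text \<open>The normalised convolution of the indicators of \<open>{A..<B}\<close> and \<open>{0..<L}\<close> modulo \<open>p\<close>: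
  its Fourier coefficients decay quadratically beyond frequency \<open>p / L\<close>, so that their sum is
  logarithmic in \<open>p / L\<close> rather than in \<open>p\<close>.\<close>

definition trapezoid :: "nat \<Rightarrow> nat \<Rightarrow> int \<Rightarrow> int \<Rightarrow> int \<Rightarrow> real" where
  "trapezoid p L A B x =
     (\<Sum>y\<in>{A..<B}. \<Sum>z\<in>{0..<int L}. if int p dvd x - y - z then 1 else 0) / real L"

definition trapezoid_coeff :: "nat \<Rightarrow> nat \<Rightarrow> int \<Rightarrow> int \<Rightarrow> int \<Rightarrow> complex" where
  "trapezoid_coeff p L A B a =
     (\<Sum>y\<in>{A..<B}. ep p (- a * y)) * (\<Sum>z\<in>{0..<int L}. ep p (- a * z)) / of_nat (p * L)"

text \<open>Orthogonality of additive characters replaces the test p | x - y - z by an average over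
  frequencies; interchanging the sums collects the coefficients.\<close>

lemma trapezoid_fourier:
  assumes "p > 0"
  shows "complex_of_real (trapezoid p L A B x) = (\<Sum>a\<in>{0..<int p}. trapezoid_coeff p L A B a * ep p (a * x))"
proof -
  have *: "(\<Sum>a\<in>{0..<int p}. ep p (- a * y) * ep p (- a * z) * ep p (a * x)) =
      of_nat p * (if int p dvd x - y - z then 1 else 0)" for y z
  proof -
    have "(\<Sum>a\<in>{0..<int p}. ep p (- a * y) * ep p (- a * z) * ep p (a * x)) =
        (\<Sum>a\<in>{0..<int p}. ep p ((x - y - z) * a))"
      by (intro sum.cong refl) (simp add: ep_add [symmetric] algebra_simps)
    then show ?thesis by (simp add: sum_ep_complete[OF assms])
  qed
  have "(\<Sum>a\<in>{0..<int p}. trapezoid_coeff p L A B a * ep p (a * x)) =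
      (\<Sum>a\<in>{0..<int p}. \<Sum>y\<in>{A..<B}. \<Sum>z\<in>{0..<int L}.
         ep p (- a * y) * ep p (- a * z) * ep p (a * x)) / of_nat (p * L)"
    unfolding sum_divide_distrib[of _ "{0..<int p}"]
  proof (rule sum.cong)
    fix a
    show "trapezoid_coeff p L A B a * ep p (a * x) = (\<Sum>y\<in>{A..<B}. \<Sum>z\<in>{0..<int L}.
         ep p (- a * y) * ep p (- a * z) * ep p (a * x)) / of_nat (p * L)"
      unfolding trapezoid_coeff_def sum_product unfolding times_divide_eq_left sum_distrib_right ..
  qed simp
  also have "\<dots> = (\<Sum>y\<in>{A..<B}. \<Sum>z\<in>{0..<int L}. \<Sum>a\<in>{0..<int p}.
         ep p (- a * y) * ep p (- a * z) * ep p (a * x)) / of_nat (p * L)"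
    by (subst sum.swap, rule arg_cong[where f = "\<lambda>u. u / _"], rule sum.cong[OF refl], rule sum.swap)
  also have "\<dots> = (\<Sum>y\<in>{A..<B}. \<Sum>z\<in>{0..<int L}. of_nat p * (if int p dvd x - y - z then 1 else 0))
      / of_nat (p * L)"
    unfolding * ..
  also have "\<dots> = complex_of_real (trapezoid p L A B x)"
    using assms unfolding trapezoid_def sum_distrib_left[symmetric]
    by (simp add: if_distrib[of complex_of_real] cong: if_cong)
  finally show ?thesis ..
qed

lemma trapezoid_nonneg: "trapezoid p L A B x \<ge> 0"
  unfolding trapezoid_def by (intro divide_nonneg_nonneg sum_nonneg) auto

text \<open>The left end is moved by L - 1 so that, for x in {A..<B}, all L shifts x - z lie in the
  summation interval; each z contributes at least 1 before normalisation.\<close>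

lemma trapezoid_majorant:
  assumes "L > 0" "A \<le> x" "x < B"
  shows "1 \<le> trapezoid p L (A - int L + 1) B x"
proof -
  have "real L = (\<Sum>z\<in>{0..<int L}. 1)" by simp
  also have "\<dots> \<le> (\<Sum>z\<in>{0..<int L}. \<Sum>y\<in>{A - int L + 1..<B}. if int p dvd x - y - z then 1 else 0)"
  proof (intro sum_mono)
    fix z assume "z \<in> {0..<int L}"
    then have "x - z \<in> {A - int L + 1..<B}" using assms by auto
    then show "(1::real) \<le> (\<Sum>y\<in>{A - int L + 1..<B}. if int p dvd x - y - z then 1 else 0)"
      by (intro order_trans[OF _ member_le_sum[of "x - z"]]) auto
  qed
  also have "\<dots> = (\<Sum>y\<in>{A - int L + 1..<B}. \<Sum>z\<in>{0..<int L}. if int p dvd x - y - z then 1 else 0)"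
    by (rule sum.swap)
  finally show ?thesis using assms(1) by (simp add: trapezoid_def)
qed

text \<open>Shortening the right end by L - 1 keeps y + z inside {A..<B}, hence inside {0..<p}, so
  the congruence of x and y + z modulo p is an equality. Each z then admits at most one y, and none
  when x is outside {A..<B}.\<close>

lemma trapezoid_minorant:
  assumes "L > 0" "0 \<le> A" "B \<le> int p" "0 \<le> x" "x < int p"
  shows "trapezoid p L A (B - int L + 1) x \<le> (if A \<le> x \<and> x < B then 1 else 0)"
proof -
  have eq: "int p dvd x - y - z \<longleftrightarrow> y = x - z"
    if "y \<in> {A..<B - int L + 1}" "z \<in> {0..<int L}" for y z
  proof
    assume "int p dvd x - y - z"
    then have "x mod int p = (y + z) mod int p"
      by (simp add: mod_eq_dvd_iff algebra_simps)
    then show "y = x - z" using assms that by simp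
  qed simp
  have "(\<Sum>y\<in>{A..<B - int L + 1}. \<Sum>z\<in>{0..<int L}. if int p dvd x - y - z then 1 else (0::real)) =
      (\<Sum>y\<in>{A..<B - int L + 1}. \<Sum>z\<in>{0..<int L}. if y = x - z then 1 else 0)"
    by (intro sum.cong refl) (simp add: eq)
  also have "\<dots> = (\<Sum>z\<in>{0..<int L}. \<Sum>y\<in>{A..<B - int L + 1}. if y = x - z then 1 else 0)"
    by (rule sum.swap)
  also have "\<dots> \<le> (\<Sum>z\<in>{0..<int L}. if A \<le> x \<and> x < B then 1 else 0)"
    by (intro sum_mono) auto
  also have "\<dots> = (if A \<le> x \<and> x < B then real L else 0)" by simp
  finally have "trapezoid p L A (B - int L + 1) x \<le> (if A \<le> x \<and> x < B then real L else 0) / real L"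
    unfolding trapezoid_def by (intro divide_right_mono) auto
  then show ?thesis using assms(1) by (cases "A \<le> x \<and> x < B") auto
qed

text \<open>H plays the role of p/L. In the minimum, the first term comes from bounding the sum over
  shifts trivially by L, the second from bounding it as a geometric sum. The value 2 at a = 0 allows
  for intervals of length up to 2p.\<close>

definition freq_weight :: "nat \<Rightarrow> nat \<Rightarrow> int \<Rightarrow> real" where
  "freq_weight p H a = (if a = 0 then 2
     else 4 * min (1 / real_of_int (circle_dist p a)) (real H / (real_of_int (circle_dist p a))\<^sup>2))"

lemma trapezoid_coeff_0:
  assumes "p > 0" "L > 0"
  shows "trapezoid_coeff p L A B 0 = of_nat (nat (B - A)) / of_nat p"
  using assms by (simp add: trapezoid_coeff_def)

lemma norm_trapezoid_coeff_le:
  assumes p: "p > 0" and L: "L > 0" and len: "B - A \<le> 2 * int p" and H: "p \<le> L * H"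
    and a: "a \<in> {0..<int p}"
  shows "cmod (trapezoid_coeff p L A B a) \<le> freq_weight p H a"
proof (cases "a = 0")
  case True
  have "real (nat (B - A)) \<le> 2 * real p" using len by linarith
  then have "cmod (of_nat (nat (B - A)) / of_nat p) \<le> 2"
    using p by (simp add: norm_divide field_simps)
  with True show ?thesis
    using trapezoid_coeff_0[OF p L] by (simp add: freq_weight_def)
next
  case False
  have nd: "\<not> int p dvd a" using a False zdvd_not_zless[of a "int p"] by auto
  have nd': "\<not> int p dvd - a" using nd by simp
  define D where "D = real_of_int (circle_dist p (- a))"
  define SI where "SI = cmod (\<Sum>y\<in>{A..<B}. ep p (- a * y))"
  define SJ where "SJ = cmod (\<Sum>z\<in>{0..<int L}. ep p (- a * z))"
  have mod: "(- a) mod int p = int p - a mod int p"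
    using nd by (simp add: zmod_zminus1_eq_if dvd_eq_mod_eq_0)
  have Deq: "circle_dist p (- a) = circle_dist p a" unfolding circle_dist_def mod by (auto simp: min_def)
  have D: "D > 0" using circle_dist_pos[OF p nd'] by (simp add: D_def)
  have SI: "SI \<le> 2 * real p / D"
    unfolding SI_def D_def by (rule norm_sum_ep_interval_le[OF p nd'])
  have SJ: "SJ \<le> 2 * real p / D"
    unfolding SJ_def D_def by (rule norm_sum_ep_interval_le[OF p nd'])
  have SJL: "SJ \<le> real L"
    unfolding SJ_def using sum_norm_le[of "{0..<int L}" "\<lambda>z. ep p (- a * z)" "\<lambda>_. 1"] by simp
  have pos: "SI \<ge> 0" "SJ \<ge> 0" by (auto simp: SI_def SJ_def)
  have eq: "cmod (trapezoid_coeff p L A B a) = SI * SJ / (real p * real L)"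
    by (simp add: trapezoid_coeff_def norm_mult norm_divide SI_def SJ_def)
  have "SI * SJ \<le> (2 * real p / D) * real L"
    using SI SJL pos D by (intro mult_mono) auto
  then have "SI * SJ / (real p * real L) \<le> (2 * real p / D) * real L / (real p * real L)"
    using p L by (intro divide_right_mono) auto
  also have "\<dots> = 2 * (1 / D)" using p L by simp
  also have "\<dots> \<le> 4 * (1 / D)" using D by (intro mult_right_mono) auto
  finally have 1: "SI * SJ / (real p * real L) \<le> 4 * (1 / D)" .
  have "SI * SJ \<le> (2 * real p / D) * (2 * real p / D)"
    using SI SJ pos D by (intro mult_mono) auto
  then have "SI * SJ / (real p * real L) \<le> (2 * real p / D) * (2 * real p / D) / (real p * real L)"
    using p L by (intro divide_right_mono) auto
  also have "\<dots> = 4 * ((real p / real L) / D\<^sup>2)"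
    using p by (simp add: field_simps power2_eq_square)
  also have "\<dots> \<le> 4 * (real H / D\<^sup>2)"
  proof -
    have "real p \<le> real H * real L" using H by (metis mult.commute of_nat_le_iff of_nat_mult)
    then show ?thesis using L D by (intro mult_left_mono divide_right_mono) (auto simp: field_simps)
  qed
  finally have 2: "SI * SJ / (real p * real L) \<le> 4 * (real H / D\<^sup>2)" .
  show ?thesis
    using 1 2 False by (simp add: eq freq_weight_def D_def Deq min_def)
qed

lemma trapezoid_product_fourier:
  fixes x :: "nat \<Rightarrow> nat \<Rightarrow> int"
  assumes "p > 0"
  shows "complex_of_real (\<Sum>n<N. \<Prod>j<m. trapezoid p L (A j) (B j) (x n j)) =
    (\<Sum>a\<in>PiE {..<m} (\<lambda>_. {0..<int p}). (\<Prod>j<m. trapezoid_coeff p L (A j) (B j) (a j)) *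
       (\<Sum>n<N. ep p (\<Sum>j<m. a j * x n j)))"
proof -
  have "complex_of_real (\<Sum>n<N. \<Prod>j<m. trapezoid p L (A j) (B j) (x n j)) =
      (\<Sum>n<N. \<Prod>j<m. \<Sum>a\<in>{0..<int p}. trapezoid_coeff p L (A j) (B j) a * ep p (a * x n j))"
    by (simp add: trapezoid_fourier[OF assms])
  also have "\<dots> = (\<Sum>n<N. \<Sum>a\<in>PiE {..<m} (\<lambda>_. {0..<int p}).
      \<Prod>j<m. trapezoid_coeff p L (A j) (B j) (a j) * ep p (a j * x n j))"
    by (subst prod_sum_PiE) auto
  also have "\<dots> = (\<Sum>a\<in>PiE {..<m} (\<lambda>_. {0..<int p}). \<Sum>n<N.
      \<Prod>j<m. trapezoid_coeff p L (A j) (B j) (a j) * ep p (a j * x n j))"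
    by (rule sum.swap)
  finally show ?thesis
    by (simp add: prod.distrib ep_sum sum_distrib_left)
qed

section \<open>Discrepancy and exponential sums\<close>

lemma sum_inverse_le_ln:
  assumes "n > 0"
  shows "(\<Sum>b=1..n. 1 / real b) \<le> 1 + ln (real n)"
  using assms
proof (induction n rule: nat_induct_non_zero)
  case (Suc n)
  have "ln (real n / real (Suc n)) \<le> real n / real (Suc n) - 1"
    using Suc.hyps by (intro ln_le_minus_one) simp
  then have "ln (real n) - ln (real (Suc n)) \<le> - (1 / real (Suc n))"
    using Suc.hyps by (simp add: ln_div field_simps)
  then show ?case using Suc.IH by simp
qed simp

lemma sum_min_inverse_le:
  assumes "H > 0"
  shows "(\<Sum>b=1..n. min (1 / real b) (real H / (real b)\<^sup>2)) \<le> 2 + ln (real H)"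
proof -
  define \<phi> where "\<phi> b = min (1 / real b) (real H / (real b)\<^sup>2)" for b
  \<comment> \<open>The subtracted H/n makes the induction telescope, as H/(n+1)^2 <= H/n - H/(n+1).
    At n = H it equals 1, so the harmonic bound 1 + ln H starts the induction.\<close>
  have tail: "(\<Sum>b=1..n. \<phi> b) \<le> 2 + ln (real H) - real H / real n" if "H \<le> n" for n
    using that
  proof (induction n rule: dec_induct)
    case base
    have "(\<Sum>b=1..H. \<phi> b) \<le> (\<Sum>b=1..H. 1 / real b)"
      by (intro sum_mono) (simp add: \<phi>_def)
    then show ?case using sum_inverse_le_ln[OF assms] assms by simp
  next
    case (step n)
    have n: "n > 0" using assms step.hyps by linarith
    have "\<phi> (Suc n) \<le> real H / (real (Suc n))\<^sup>2" by (simp add: \<phi>_def)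
    also have "\<dots> \<le> real H / (real n * real (Suc n))"
      using n by (intro divide_left_mono) (auto simp: power2_eq_square)
    also have "\<dots> = real H / real n - real H / real (Suc n)"
      using n by (simp add: divide_simps) (simp add: algebra_simps)
    finally show ?case using step.IH by simp
  qed
  have "(\<Sum>b=1..n. \<phi> b) \<le> (\<Sum>b=1..max n H. \<phi> b)"
    by (intro sum_mono2) (auto simp: \<phi>_def)
  also have "\<dots> \<le> 2 + ln (real H)"
    by (rule order_trans[OF tail]) auto
  finally show ?thesis by (simp add: \<phi>_def)
qed

lemma freq_weight_nonneg:
  assumes "p > 0" "a \<in> {0..<int p}"
  shows "freq_weight p H a \<ge> 0"
  using assms by (auto simp: freq_weight_def circle_dist_def)

lemma sum_freq_weight_le:
  assumes "p > 0" "H > 0"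
  shows "(\<Sum>a\<in>{0..<int p}. freq_weight p H a) \<le> 18 + 8 * ln (real H)"
proof -
  define \<phi> where "\<phi> b = min (1 / real b) (real H / (real b)\<^sup>2)" for b
  have \<phi>_nonneg: "\<phi> b \<ge> 0" for b by (simp add: \<phi>_def)
  have S: "(\<Sum>b=1..<p. \<phi> b) \<le> 2 + ln (real H)"
    using sum_min_inverse_le[OF assms(2), of "p - 1"] assms(1)
    by (simp add: \<phi>_def atLeastLessThanSuc_atLeastAtMost[symmetric])
  have eq: "int ` {0..<p} = {0..<int p}" by (simp add: image_int_atLeastLessThan)
  have "(\<Sum>a\<in>{0..<int p}. freq_weight p H a) = (\<Sum>b\<in>{0..<p}. freq_weight p H (int b))"
    unfolding eq[symmetric] by (subst sum.reindex) auto
  also have "\<dots> = 2 + (\<Sum>b=1..<p. freq_weight p H (int b))"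
    using assms(1) by (subst sum.atLeast_Suc_lessThan) (simp_all add: freq_weight_def)
  \<comment> \<open>The circular distance of b is b or p - b. Both candidates are kept, and the
    reflection b -> p - b makes the two sums equal; the total is at most 2 + 8 (2 + ln H).\<close>
  also have "(\<Sum>b=1..<p. freq_weight p H (int b)) \<le> (\<Sum>b=1..<p. 4 * (\<phi> b + \<phi> (p - b)))"
  proof (intro sum_mono)
    fix b assume b: "b \<in> {1..<p}"
    have "circle_dist p (int b) = int b \<or> circle_dist p (int b) = int (p - b)"
      using b by (auto simp: circle_dist_def min_def of_nat_diff)
    then obtain c where c: "circle_dist p (int b) = int c" "c = b \<or> c = p - b" by blast
    have "freq_weight p H (int b) = 4 * \<phi> c"
      using b c(1) by (simp add: freq_weight_def \<phi>_def)
    also have "\<dots> \<le> 4 * (\<phi> b + \<phi> (p - b))"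
      using c(2) \<phi>_nonneg by (auto simp: add_increasing add_increasing2)
    finally show "freq_weight p H (int b) \<le> 4 * (\<phi> b + \<phi> (p - b))" .
  qed
  also have "\<dots> = 4 * ((\<Sum>b=1..<p. \<phi> b) + (\<Sum>b=1..<p. \<phi> (p - b)))"
    by (simp add: sum_distrib_left sum.distrib)
  also have "(\<Sum>b=1..<p. \<phi> (p - b)) = (\<Sum>b=1..<p. \<phi> b)"
    by (rule sum.reindex_bij_witness[of _ "\<lambda>b. p - b" "\<lambda>b. p - b"]) auto
  finally show ?thesis using S by simp
qed

section \<open>Comparing box counts with exponential sums\<close>

lemma prod_diff_le:
  fixes x y :: "'i \<Rightarrow> real"
  assumes "finite I" "\<And>i. i \<in> I \<Longrightarrow> \<bar>x i\<bar> \<le> 2" "\<And>i. i \<in> I \<Longrightarrow> \<bar>y i\<bar> \<le> 2"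
    "\<And>i. i \<in> I \<Longrightarrow> \<bar>x i - y i\<bar> \<le> \<delta>"
  shows "\<bar>prod x I - prod y I\<bar> \<le> real (card I) * 2 ^ card I * \<delta>"
proof -
  \<comment> \<open>Halving brings all factors into [-1, 1], where a difference of products is
    bounded by the sum of the differences; undoing it costs 2 ^ \<open>card I\<close>.\<close>
  have "norm ((\<Prod>i\<in>I. x i / 2) - (\<Prod>i\<in>I. y i / 2)) \<le> (\<Sum>i\<in>I. norm (x i / 2 - y i / 2))"
    using assms by (intro norm_prod_diff) auto
  also have "\<dots> \<le> (\<Sum>i\<in>I. \<delta>)"
  proof (intro sum_mono)
    fix i assume i: "i \<in> I"
    then show "norm (x i / 2 - y i / 2) \<le> \<delta>" using assms(4)[OF i] by simp
  qed
  finally have "\<bar>(prod x I - prod y I) / 2 ^ card I\<bar> \<le> real (card I) * \<delta>"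
    by (simp add: prod_dividef diff_divide_distrib)
  then show ?thesis by (simp add: field_simps)
qed

text \<open>The zero vector is left out since it carries the main term of the Fourier expansion.
  Restricting it to {..<m} makes it a member of \<open>PiE\<close>.\<close>

definition weighted_exp_sum :: "nat \<Rightarrow> nat \<Rightarrow> nat \<Rightarrow> (nat \<Rightarrow> nat \<Rightarrow> int) \<Rightarrow> nat \<Rightarrow> real" where
  "weighted_exp_sum p m H x N = (\<Sum>a\<in>PiE {..<m} (\<lambda>_. {0..<int p}) - {\<lambda>j\<in>{..<m}. 0}.
     (\<Prod>j<m. freq_weight p H (a j)) * cmod (\<Sum>n<N. ep p (\<Sum>j<m. a j * x n j)))"

text \<open>Frequency zero contributes N times the product of the normalised side lengths, which
  \<open>prod_diff_le\<close> compares with the target volume; the other frequencies go into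
  \<open>weighted_exp_sum\<close>. The same estimate serves majorants and minorants.\<close>

lemma trapezoid_box_estimate:
  fixes x :: "nat \<Rightarrow> nat \<Rightarrow> int"
  assumes p: "p > 0" and L: "L > 0" "p \<le> L * H" and N: "N > 0"
    and len: "\<And>j. j < m \<Longrightarrow> B j - A j \<le> 2 * int p"
    and y: "\<And>j. j < m \<Longrightarrow> \<bar>y j\<bar> \<le> 1"
    and \<delta>: "\<And>j. j < m \<Longrightarrow> \<bar>real (nat (B j - A j)) / real p - y j\<bar> \<le> \<delta>"
  shows "\<bar>(\<Sum>n<N. \<Prod>j<m. trapezoid p L (A j) (B j) (x n j)) / real N - (\<Prod>j<m. y j)\<bar>
    \<le> real m * 2 ^ m * \<delta> + weighted_exp_sum p m H x N / real N"
proof -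
  define z :: "nat \<Rightarrow> int" where "z = (\<lambda>j\<in>{..<m}. 0)"
  define F where "F = PiE {..<m} (\<lambda>_. {0..<int p})"
  define T where "T = (\<Sum>n<N. \<Prod>j<m. trapezoid p L (A j) (B j) (x n j))"
  define c where "c a = (\<Prod>j<m. trapezoid_coeff p L (A j) (B j) (a j))" for a
  define S where "S a = (\<Sum>n<N. ep p (\<Sum>j<m. a j * x n j))" for a
  define P where "P = (\<Prod>j<m. real (nat (B j - A j)) / real p)"
  have fin: "finite F" by (auto simp: F_def intro: finite_PiE)
  have z: "z \<in> F" using p by (auto simp: F_def z_def)
  have cz: "c z = complex_of_real P"
    using p L by (simp add: c_def z_def trapezoid_coeff_0 P_def)
  have Sz: "S z = of_nat N" by (simp add: S_def z_def)
  have "complex_of_real T = (\<Sum>a\<in>F. c a * S a)"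
    unfolding T_def F_def c_def S_def by (rule trapezoid_product_fourier[OF p])
  also have "\<dots> = c z * S z + (\<Sum>a\<in>F - {z}. c a * S a)"
    using fin z by (rule sum.remove)
  finally have "complex_of_real T - complex_of_real (P * real N) = (\<Sum>a\<in>F - {z}. c a * S a)"
    by (simp add: cz Sz)
  then have "\<bar>T - P * real N\<bar> = cmod (\<Sum>a\<in>F - {z}. c a * S a)"
    by (metis norm_of_real of_real_diff real_norm_def)
  also have "\<dots> \<le> weighted_exp_sum p m H x N"
    unfolding weighted_exp_sum_def
  proof (fold z_def F_def, intro sum_norm_le)
    fix a assume "a \<in> F - {z}"
    then have a: "\<And>j. j < m \<Longrightarrow> a j \<in> {0..<int p}" by (auto simp: F_def PiE_def Pi_def)
    have "cmod (c a) \<le> (\<Prod>j<m. freq_weight p H (a j))"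
      unfolding c_def prod_norm[symmetric]
    proof (intro prod_mono conjI)
      fix j assume "j \<in> {..<m}"
      then show "cmod (trapezoid_coeff p L (A j) (B j) (a j)) \<le> freq_weight p H (a j)"
        using norm_trapezoid_coeff_le[OF p L(1) len L(2) a] by auto
    qed auto
    then show "cmod (c a * S a) \<le> (\<Prod>j<m. freq_weight p H (a j)) * cmod (\<Sum>n<N. ep p (\<Sum>j<m. a j * x n j))"
      unfolding norm_mult S_def by (intro mult_right_mono) auto
  qed
  finally have "\<bar>T - P * real N\<bar> / real N \<le> weighted_exp_sum p m H x N / real N"
    by (rule divide_right_mono) simp
  moreover have "T / real N - P = (T - P * real N) / real N"
    using N by (simp add: diff_divide_distrib)
  ultimately have 1: "\<bar>T / real N - P\<bar> \<le> weighted_exp_sum p m H x N / real N"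
    by (simp add: abs_divide)
  have "\<bar>P - (\<Prod>j<m. y j)\<bar> \<le> real (card {..<m}) * 2 ^ card {..<m} * \<delta>"
    unfolding P_def
  proof (intro prod_diff_le)
    fix j assume j: "j \<in> {..<m}"
    have "real (nat (B j - A j)) \<le> 2 * real p" using len[of j] j by simp
    then show "\<bar>real (nat (B j - A j)) / real p\<bar> \<le> 2" using p by (simp add: field_simps)
    show "\<bar>y j\<bar> \<le> 2" using y[of j] j by simp
    show "\<bar>real (nat (B j - A j)) / real p - y j\<bar> \<le> \<delta>" using \<delta>[of j] j by simp
  qed simp
  then show ?thesis using 1 by (simp add: T_def)
qed

text \<open>An inequality of Erdos-Turan-Koksma type with frequency cutoff H: the indicator of each
  box is squeezed between products of trapezoids whose slopes have width about p/H.\<close>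

lemma discrepancy_le:
  fixes x :: "nat \<Rightarrow> nat \<Rightarrow> int"
  assumes p: "p > 0" and H: "H > 0" and N: "N > 0"
    and x: "\<And>n j. j < m \<Longrightarrow> x n j \<in> {0..<int p}"
  shows "discrepancy m (\<lambda>n j. real_of_int (x n j) / real p) N \<le>
    real m * 2 ^ m * (1 / real H + 1 / real p) + weighted_exp_sum p m H x N / real N"
proof -
  \<comment> \<open>This is p/H rounded up, whence p <= L H <= p + H and 1 <= L <= p.\<close>
  define L where "L = (p - 1) div H + 1"
  have L0: "L > 0" by (simp add: L_def)
  have Lp: "L \<le> p" using p div_le_dividend[of "p - 1" H] unfolding L_def by linarith
  have "L * H = (p - 1) div H * H + H"
    by (simp add: L_def)
  then have LH: "p \<le> L * H" "L * H \<le> p + H"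
    using div_mult_mod_eq[of "p - 1" H] mod_less_divisor[OF H, of "p - 1"] p by linarith+
  define \<delta> where "\<delta> = real L / real p"
  have \<delta>: "\<delta> \<le> 1 / real H + 1 / real p"
  proof -
    have "real (L * H) \<le> real (p + H)" using LH(2) by (simp only: of_nat_le_iff)
    then have "real L * real H / (real p * real H) \<le> (real p + real H) / (real p * real H)"
      by (intro divide_right_mono) auto
    then show ?thesis using p H by (simp add: \<delta>_def add_divide_distrib add.commute)
  qed
  show ?thesis
    unfolding discrepancy_def
  proof (rule cSUP_least, goal_cases)
    case 1
    have "((\<lambda>_. 0), (\<lambda>_. 0)) \<in> {(\<alpha>, \<beta>). \<forall>j<m. 0 \<le> \<alpha> j \<and> \<alpha> j \<le> \<beta> j \<and> \<beta> j \<le> (1::real)}" by simp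
    then show ?case by (rule ex_in_conv[THEN iffD1, OF exI])
  next
    case (2 ab)
    obtain \<alpha> \<beta> where ab: "ab = (\<alpha>, \<beta>)" by (cases ab)
    from 2 have box: "\<And>j. j < m \<Longrightarrow> 0 \<le> \<alpha> j" "\<And>j. j < m \<Longrightarrow> \<alpha> j \<le> \<beta> j" "\<And>j. j < m \<Longrightarrow> \<beta> j \<le> 1"
      by (auto simp: ab)
    \<comment> \<open>Since the numerators of the points are integers, rounding both ends of the
      half-open sides up leaves the counted points unchanged; each normalised side length moves by
      at most 1/p.\<close>
    define A where "A j = \<lceil>real p * \<alpha> j\<rceil>" for j
    define B where "B j = \<lceil>real p * \<beta> j\<rceil>" for j
    have AB: "0 \<le> A j" "A j \<le> B j" "B j \<le> int p" if "j < m" for j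
    proof -
      show "0 \<le> A j" using box(1)[OF that] by (simp add: A_def) (smt (verit) mult_nonneg_nonneg of_nat_0_le_iff)
      show "A j \<le> B j" unfolding A_def B_def using box(2)[OF that] by (intro ceiling_mono mult_left_mono) auto
      have "real p * \<beta> j \<le> real p * 1" using box(3)[OF that] by (intro mult_left_mono) auto
      then show "B j \<le> int p" by (simp add: B_def ceiling_le_iff)
    qed
    have near: "\<bar>real_of_int (B j - A j) / real p - (\<beta> j - \<alpha> j)\<bar> \<le> 1 / real p" for j
    proof -
      have "\<bar>real_of_int (B j - A j) - real p * (\<beta> j - \<alpha> j)\<bar> \<le> 1"
        unfolding A_def B_def right_diff_distrib by linarith
      then have "\<bar>real_of_int (B j - A j) - real p * (\<beta> j - \<alpha> j)\<bar> / real p \<le> 1 / real p"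
        by (intro divide_right_mono) auto
      moreover have "real_of_int (B j - A j) / real p - (\<beta> j - \<alpha> j) =
          (real_of_int (B j - A j) - real p * (\<beta> j - \<alpha> j)) / real p"
        using p by (simp add: diff_divide_distrib)
      ultimately show ?thesis by (simp add: abs_divide)
    qed
    define G where "G n = (\<Prod>j<m. if A j \<le> x n j \<and> x n j < B j then 1 else 0 :: real)" for n
    have cardG: "real (card {n. n < N \<and> (\<forall>j<m. \<alpha> j \<le> real_of_int (x n j) / real p \<and> real_of_int (x n j) / real p < \<beta> j)})
        = (\<Sum>n<N. G n)"
    proof -
      have G: "G n = (if \<forall>j<m. \<alpha> j \<le> real_of_int (x n j) / real p \<and> real_of_int (x n j) / real p < \<beta> j
          then 1 else 0)" for n
      proof -
        have "\<alpha> j \<le> real_of_int (x n j) / real p \<longleftrightarrow> A j \<le> x n j"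
          "real_of_int (x n j) / real p < \<beta> j \<longleftrightarrow> x n j < B j" for j
          using p by (simp_all add: A_def B_def ceiling_le_iff less_ceiling_iff field_simps)
        then show ?thesis by (auto simp: G_def prod_zero_iff intro!: prod.neutral)
      qed
      show ?thesis
        unfolding G by (subst sum.inter_filter[symmetric]) (auto intro!: arg_cong[where f = card])
    qed
    have "(\<Sum>n<N. G n) / real N - (\<Prod>j<m. \<beta> j - \<alpha> j) \<le> real m * 2 ^ m * \<delta> + weighted_exp_sum p m H x N / real N"
    proof -
      have "G n \<le> (\<Prod>j<m. trapezoid p L (A j - int L + 1) (B j) (x n j))" for n
        unfolding G_def using trapezoid_majorant[OF L0] trapezoid_nonneg by (intro prod_mono) auto
      then have "(\<Sum>n<N. G n) / real N \<le> (\<Sum>n<N. \<Prod>j<m. trapezoid p L (A j - int L + 1) (B j) (x n j)) / real N"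
        by (intro divide_right_mono sum_mono) auto
      moreover have "\<bar>(\<Sum>n<N. \<Prod>j<m. trapezoid p L (A j - int L + 1) (B j) (x n j)) / real N - (\<Prod>j<m. \<beta> j - \<alpha> j)\<bar>
          \<le> real m * 2 ^ m * \<delta> + weighted_exp_sum p m H x N / real N"
      proof (rule trapezoid_box_estimate[OF p L0 LH(1) N])
        fix j assume j: "j < m"
        show "B j - (A j - int L + 1) \<le> 2 * int p" using AB[OF j] Lp by linarith
        show "\<bar>\<beta> j - \<alpha> j\<bar> \<le> 1" using box[OF j] by linarith
        \<comment> \<open>Lengthening by L - 1 adds \<delta> - 1/p and rounding at most 1/p,
          together at most \<delta>.\<close>
        have "real (nat (B j - (A j - int L + 1))) = real_of_int (B j - A j) + (real L - 1)"
          using AB[OF j] L0 by simp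
        then have "real (nat (B j - (A j - int L + 1))) / real p - (\<beta> j - \<alpha> j) =
            (real_of_int (B j - A j) / real p - (\<beta> j - \<alpha> j)) + (\<delta> - 1 / real p)"
          by (simp add: \<delta>_def add_divide_distrib diff_divide_distrib)
        moreover have "1 / real p \<le> \<delta>" using L0 by (simp add: \<delta>_def divide_right_mono)
        ultimately show "\<bar>real (nat (B j - (A j - int L + 1))) / real p - (\<beta> j - \<alpha> j)\<bar> \<le> \<delta>"
          using near[of j] by linarith
      qed
      ultimately show ?thesis by linarith
    qed
    moreover have "(\<Sum>n<N. G n) / real N - (\<Prod>j<m. \<beta> j - \<alpha> j) \<ge> - (real m * 2 ^ m * \<delta> + weighted_exp_sum p m H x N / real N)"
    proof -
      have "(\<Prod>j<m. trapezoid p L (A j) (B j - int L + 1) (x n j)) \<le> G n" for n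
        unfolding G_def
      proof (intro prod_mono conjI trapezoid_nonneg)
        fix j assume "j \<in> {..<m}"
        then show "trapezoid p L (A j) (B j - int L + 1) (x n j) \<le> (if A j \<le> x n j \<and> x n j < B j then 1 else 0)"
          using AB x by (intro trapezoid_minorant[OF L0]) auto
      qed
      then have "(\<Sum>n<N. \<Prod>j<m. trapezoid p L (A j) (B j - int L + 1) (x n j)) / real N \<le> (\<Sum>n<N. G n) / real N"
        by (intro divide_right_mono sum_mono) auto
      moreover have "\<bar>(\<Sum>n<N. \<Prod>j<m. trapezoid p L (A j) (B j - int L + 1) (x n j)) / real N - (\<Prod>j<m. \<beta> j - \<alpha> j)\<bar>
          \<le> real m * 2 ^ m * \<delta> + weighted_exp_sum p m H x N / real N"
      proof (rule trapezoid_box_estimate[OF p L0 LH(1) N])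
        fix j assume j: "j < m"
        show "B j - int L + 1 - A j \<le> 2 * int p" using AB[OF j] L0 by linarith
        show "\<bar>\<beta> j - \<alpha> j\<bar> \<le> 1" using box[OF j] by linarith
        \<comment> \<open>When the side is shorter than L - 1 the interval is empty and
          \<open>nat\<close> cuts its length to 0, so the length is only enclosed between two
          bounds.\<close>
        define k where "k = nat (B j - int L + 1 - A j)"
        have "real_of_int (B j - A j) - (real L - 1) \<le> real k" "real k \<le> real_of_int (B j - A j)"
          using AB[OF j] L0 by (auto simp: k_def)
        then have "(real_of_int (B j - A j) - (real L - 1)) / real p \<le> real k / real p"
          "real k / real p \<le> real_of_int (B j - A j) / real p"
          by (intro divide_right_mono; simp)+
        then have "real_of_int (B j - A j) / real p - (\<delta> - 1 / real p) \<le> real k / real p"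
          "real k / real p \<le> real_of_int (B j - A j) / real p"
          by (simp_all add: \<delta>_def diff_divide_distrib add_divide_distrib)
        moreover have "1 / real p \<le> \<delta>" using L0 by (simp add: \<delta>_def divide_right_mono)
        ultimately show "\<bar>real (nat (B j - int L + 1 - A j)) / real p - (\<beta> j - \<alpha> j)\<bar> \<le> \<delta>"
          using near[of j] unfolding k_def[symmetric] by linarith
      qed
      ultimately show ?thesis by linarith
    qed
    moreover have "real m * 2 ^ m * \<delta> \<le> real m * 2 ^ m * (1 / real H + 1 / real p)"
      using \<delta> by (intro mult_left_mono) auto
    ultimately show ?case unfolding ab prod.case cardG by (intro abs_leI) linarith+
  qed
qed

section \<open>Dyadic control of all initial segments\<close>

lemma norm_prefix_sum_le_dyadic:
  fixes z :: "nat \<Rightarrow> complex"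
  assumes "N < 2 ^ J"
  shows "cmod (\<Sum>n<N. z n) \<le>
    (\<Sum>l<J. sqrt (\<Sum>b<2 ^ (J - l). (cmod (\<Sum>n\<in>{b * 2 ^ l..<b * 2 ^ l + 2 ^ l}. z n))\<^sup>2))"
proof -
  \<comment> \<open>\<open>s l\<close> is the sum up to N truncated to a multiple of 2^l. Passing
    from l + 1 to l adds one aligned block of length 2^l if the corresponding binary digit of N is
    1, and nothing otherwise; \<open>s J\<close> is empty because N < 2^J.\<close>
  define s where "s l = (\<Sum>n<2 ^ l * (N div 2 ^ l). z n)" for l
  have "(\<Sum>n<N. z n) = s 0 - s J"
    using assms by (simp add: s_def)
  also have "\<dots> = (\<Sum>l<J. s l - s (Suc l))"
    by (rule sum_lessThan_telescope'[symmetric])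
  also have "cmod \<dots> \<le>
      (\<Sum>l<J. sqrt (\<Sum>b<2 ^ (J - l). (cmod (\<Sum>n\<in>{b * 2 ^ l..<b * 2 ^ l + 2 ^ l}. z n))\<^sup>2))"
  proof (rule sum_norm_le)
    fix l assume "l \<in> {..<J}"
    then have l: "l < J" by simp
    define b where "b = 2 * (N div 2 ^ Suc l)"
    define X where "X b = (cmod (\<Sum>n\<in>{b * 2 ^ l..<b * 2 ^ l + 2 ^ l}. z n))\<^sup>2" for b
    have Xn: "X b \<ge> 0" for b by (simp add: X_def)
    have div: "N div 2 ^ Suc l = N div 2 ^ l div 2"
      by (simp add: power_Suc2 div_mult2_eq del: power_Suc)
    have sl: "s (Suc l) = (\<Sum>n<b * 2 ^ l. z n)" by (simp add: s_def b_def mult_ac)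
    show "cmod (s l - s (Suc l)) \<le> sqrt (\<Sum>b<2 ^ (J - l). X b)"
    proof (cases "even (N div 2 ^ l)")
      case True
      then have "b = N div 2 ^ l" unfolding b_def div by simp
      then have "s l = s (Suc l)" unfolding sl by (simp add: s_def mult.commute)
      then show ?thesis by (simp add: sum_nonneg Xn)
    next
      case False
      then have b: "N div 2 ^ l = b + 1" unfolding b_def div by (simp add: odd_two_times_div_two_succ)
      have "s l = (\<Sum>n<b * 2 ^ l + 2 ^ l. z n)" by (simp add: s_def b algebra_simps)
      also have "\<dots> = s (Suc l) + (\<Sum>n\<in>{b * 2 ^ l..<b * 2 ^ l + 2 ^ l}. z n)"
        unfolding sl lessThan_atLeast0 by (rule sum.atLeastLessThan_concat[symmetric]) auto
      finally have "(cmod (s l - s (Suc l)))\<^sup>2 = X b" by (simp add: X_def)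
      \<comment> \<open>The single block is replaced by all blocks of its length, so that the bound
        no longer depends on N.\<close>
      also have "\<dots> \<le> (\<Sum>b<2 ^ (J - l). X b)"
      proof (rule member_le_sum)
        have "N < 2 ^ (J - l) * 2 ^ l" using assms l by (simp flip: power_add)
        then have "N div 2 ^ l < 2 ^ (J - l)" by (simp add: less_mult_imp_div_less)
        then show "b \<in> {..<2 ^ (J - l)}" using b by simp
      qed (auto simp: Xn)
      finally show ?thesis by (rule real_le_rsqrt)
    qed
  qed
  finally show ?thesis .
qed

lemma sum_sqrt_le:
  assumes "\<And>i. i \<in> I \<Longrightarrow> f i \<ge> 0"
  shows "(\<Sum>i\<in>I. sqrt (f i)) \<le> sqrt (real (card I) * (\<Sum>i\<in>I. f i))"
proof (rule real_le_rsqrt)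
  have "(\<Sum>i\<in>I. 1 * sqrt (f i))\<^sup>2 \<le> (\<Sum>i\<in>I. 1\<^sup>2) * (\<Sum>i\<in>I. (sqrt (f i))\<^sup>2)"
    by (rule Cauchy_Schwarz_ineq_sum)
  also have "(\<Sum>i\<in>I. (sqrt (f i))\<^sup>2) = (\<Sum>i\<in>I. f i)"
    using assms by (intro sum.cong) auto
  finally show "(\<Sum>i\<in>I. sqrt (f i))\<^sup>2 \<le> real (card I) * (\<Sum>i\<in>I. f i)" by simp
qed

section \<open>Iterates of triangular maps\<close>

lemma card_roots_mod_prime:
  fixes P :: "int poly"
  assumes "prime p" "\<not> int p dvd lead_coeff P"
  shows "card {y \<in> {0..<int p}. int p dvd poly P y} \<le> degree P"
  using assms(2)
proof (induction "degree P" arbitrary: P)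
  case 0
  then obtain c where "P = [:c:]" by (metis degree_eq_zeroE)
  with 0 have "{y \<in> {0..<int p}. int p dvd poly P y} = {}" by auto
  then show ?case by (simp only: card.empty zero_le)
next
  case (Suc n)
  show ?case
  proof (cases "\<exists>r. int p dvd poly P r \<and> r \<in> {0..<int p}")
    case False
    then have "{y \<in> {0..<int p}. int p dvd poly P y} = {}" by blast
    then show ?thesis by (simp only: card.empty zero_le)
  next
    case True
    then obtain r where r: "int p dvd poly P r" "r \<in> {0..<int p}" by blast
    \<comment> \<open>Lagrange's argument over the integers: P = (X - r) Q + P(r), where P(r) need
      not vanish but is divisible by p, and Q inherits the leading coefficient.\<close>
    define Q where "Q = synthetic_div P r"
    have P: "P = [:- r, 1:] * Q + [:poly P r:]"
      by (simp only: Q_def synthetic_div_correct')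
    have degQ: "degree Q = n" using Suc(2) by (simp add: Q_def degree_synthetic_div)
    have "coeff P (Suc n) = coeff ([:- r, 1:] * Q + [:poly P r:]) (Suc n)" by (subst P) simp
    also have "\<dots> = coeff Q n" by (simp add: coeff_eq_0 degQ)
    finally have lead: "lead_coeff P = lead_coeff Q" by (simp add: degQ Suc(2)[symmetric])
    have IH: "card {y \<in> {0..<int p}. int p dvd poly Q y} \<le> n"
      using Suc(1)[of Q] Suc(3) degQ lead by simp
    have "{y \<in> {0..<int p}. int p dvd poly P y} \<subseteq> insert r {y \<in> {0..<int p}. int p dvd poly Q y}"
    proof
      fix y assume "y \<in> {y \<in> {0..<int p}. int p dvd poly P y}"
      then have y: "y \<in> {0..<int p}" "int p dvd poly P y" by auto
      have "poly P y = (y - r) * poly Q y + poly P r"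
        by (subst P) (simp add: algebra_simps)
      then have "int p dvd (y - r) * poly Q y"
        using y(2) r(1) by (simp add: dvd_add_left_iff)
      then consider "int p dvd y - r" | "int p dvd poly Q y"
        using assms(1) by (metis prime_dvd_mult_iff prime_nat_int_transfer)
      then show "y \<in> insert r {y \<in> {0..<int p}. int p dvd poly Q y}"
      proof cases
        case 1
        then have "y mod int p = r mod int p" by (simp add: mod_eq_dvd_iff)
        then show ?thesis using y(1) r(2) by simp
      qed (use y in auto)
    qed
    moreover have "finite {y \<in> {0..<int p}. int p dvd poly Q y}"
      by (rule finite_subset[of _ "{0..<int p}"]) auto
    ultimately have "card {y \<in> {0..<int p}. int p dvd poly P y} \<le>
        card (insert r {y \<in> {0..<int p}. int p dvd poly Q y})"
      by (intro card_mono finite.insertI)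
    also have "\<dots> \<le> Suc (card {y \<in> {0..<int p}. int p dvd poly Q y})"
      by (intro card_insert_le_m1) auto
    finally show ?thesis using IH Suc(2) by simp
  qed
qed

section \<open>Sums over the vectors of F_p^(m+1)\<close>

lemma finite_Fp_vecs [simp, intro]: "finite (Fp_vecs p m)"
  by (auto simp: Fp_vecs_def intro: finite_PiE)

lemma card_Fp_vecs: "card (Fp_vecs p m) = p ^ (m + 1)"
  by (simp add: Fp_vecs_def card_PiE)

lemma Fp_vecs_upd: "w \<in> Fp_vecs p m \<Longrightarrow> i \<le> m \<Longrightarrow> y \<in> {0..<int p} \<Longrightarrow> w(i := y) \<in> Fp_vecs p m"
  by (auto simp: Fp_vecs_def PiE_def Pi_def extensional_def)

lemma Fp_vecs_range: "w \<in> Fp_vecs p m \<Longrightarrow> i \<le> m \<Longrightarrow> w i \<in> {0..<int p}"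
  by (auto simp: Fp_vecs_def PiE_def Pi_def)

text \<open>This lets a single coordinate be summed first without writing the set of vectors as a
  product. The involution (w, y) -> (w(i := y), w i) matches the two double sums.\<close>

lemma sum_Fp_vecs_coord:
  fixes \<phi> :: "(nat \<Rightarrow> int) \<Rightarrow> 'a :: comm_semiring_1"
  assumes "i \<le> m"
  shows "(\<Sum>w\<in>Fp_vecs p m. \<Sum>y\<in>{0..<int p}. \<phi> (w(i := y))) = of_nat p * (\<Sum>w\<in>Fp_vecs p m. \<phi> w)"
proof -
  have "(\<Sum>w\<in>Fp_vecs p m. \<Sum>y\<in>{0..<int p}. \<phi> (w(i := y))) =
      (\<Sum>(w, y)\<in>Fp_vecs p m \<times> {0..<int p}. \<phi> (w(i := y)))"
    by (rule sum.cartesian_product)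
  also have "\<dots> = (\<Sum>(w, y)\<in>Fp_vecs p m \<times> {0..<int p}. \<phi> w)"
    by (rule sum.reindex_bij_witness[of _ "\<lambda>(w, y). (w(i := y), w i)" "\<lambda>(w, y). (w(i := y), w i)"])
      (use assms Fp_vecs_upd Fp_vecs_range in \<open>auto simp: split_beta\<close>)
  also have "\<dots> = (\<Sum>w\<in>Fp_vecs p m. \<Sum>y\<in>{0..<int p}. \<phi> w)"
    by (rule sum.cartesian_product[symmetric])
  finally show ?thesis by (simp add: sum_distrib_left)
qed

text \<open>The properties of the polynomial system that the argument uses, stated for functions.
  \<open>c i w\<close> is g_i as a polynomial in coordinate i + 1, the later coordinates being
  frozen at those of w. For the systems in question its leading coefficient is a product of powers
  of those coordinates, so \<open>c_deg\<close> asks for a unit modulo p only where they are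
  nonzero.\<close>

locale triangular_map =
  fixes p m d :: nat and F :: "(nat \<Rightarrow> int) \<Rightarrow> nat \<Rightarrow> int"
    and g h :: "nat \<Rightarrow> (nat \<Rightarrow> int) \<Rightarrow> int" and c :: "nat \<Rightarrow> (nat \<Rightarrow> int) \<Rightarrow> int poly"
  assumes prime: "prime p"
    and bij: "bij_betw F (Fp_vecs p m) (Fp_vecs p m)"
    and step: "\<And>w j. w \<in> Fp_vecs p m \<Longrightarrow> j \<le> m \<Longrightarrow> F w j = (w j * g j w + h j w) mod int p"
    and g_cong: "\<And>j w w'. j \<le> m \<Longrightarrow> (\<And>i. i \<in> {j<..m} \<Longrightarrow> w i = w' i) \<Longrightarrow> g j w = g j w'"
    and h_cong: "\<And>j w w'. j \<le> m \<Longrightarrow> (\<And>i. i \<in> {j<..m} \<Longrightarrow> w i = w' i) \<Longrightarrow> h j w = h j w'"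
    and g_poly: "\<And>i w. i < m \<Longrightarrow> [g i w = poly (c i w) (w (Suc i))] (mod int p)"
    and c_cong: "\<And>i w w'. i < m \<Longrightarrow> (\<And>j. j \<in> {Suc i<..m} \<Longrightarrow> w j = w' j) \<Longrightarrow> c i w = c i w'"
    and c_deg: "\<And>i w. i < m \<Longrightarrow> w \<in> Fp_vecs p m \<Longrightarrow> (\<And>j. j \<in> {Suc i<..m} \<Longrightarrow> w j \<noteq> 0) \<Longrightarrow>
      degree (c i w) \<in> {1..d} \<and> \<not> int p dvd lead_coeff (c i w)"
begin

abbreviation "V \<equiv> Fp_vecs p m"

lemma p_pos: "p > 0" and p_gt_1: "p > 1"
  using prime prime_gt_0_nat prime_gt_1_nat by blast+

lemma bij_iter: "bij_betw (F ^^ t) V V"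
proof (induction t)
  case (Suc t)
  then show ?case unfolding funpow.simps using bij by (rule bij_betw_trans)
qed (simp add: bij_betw_def)

lemma iter_in: "w \<in> V \<Longrightarrow> (F ^^ t) w \<in> V"
  using bij_iter bij_betwE by blast

lemma iter_cong:
  assumes "w \<in> V" "w' \<in> V" "\<And>i. i \<in> {j..m} \<Longrightarrow> w i = w' i" "i \<in> {j..m}"
  shows "(F ^^ t) w i = (F ^^ t) w' i"
  using assms(4)
proof (induction t arbitrary: i)
  case (Suc t)
  have "g i ((F ^^ t) w) = g i ((F ^^ t) w')" "h i ((F ^^ t) w) = h i ((F ^^ t) w')"
    using Suc by (auto intro!: g_cong h_cong)
  then show ?case
    using Suc assms(1,2) by (simp add: step iter_in)
qed (use assms in auto)

text \<open>By triangularity \<open>F\<close> induces a map on the coordinates \<open>\<ge> j\<close>; being surjective, that map is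
  injective, and a zero of \<open>g j\<close> would make it forget coordinate \<open>j\<close>.\<close>

lemma g_nonzero:
  assumes j: "j \<le> m" and w: "w \<in> V"
  shows "\<not> int p dvd g j w"
proof
  assume dvd: "int p dvd g j w"
  \<comment> \<open>Setting the coordinates below j to zero models the projection to the coordinates
    >= j inside \<open>V\<close>; \<Phi> is the map that F induces there.\<close>
  define tr where "tr u = (\<lambda>i\<in>{..m}. if i < j then 0 else u i)" for u :: "nat \<Rightarrow> int"
  have tr_in: "tr u \<in> V" if "u \<in> V" for u
    using that p_pos by (auto simp: tr_def Fp_vecs_def PiE_def Pi_def extensional_def)
  have tr_cong: "tr u = tr u'" if "\<And>i. i \<in> {j..m} \<Longrightarrow> u i = u' i" for u u'
    using that by (auto simp: tr_def fun_eq_iff)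
  have tr_F: "tr (F (tr u)) = tr (F u)" if "u \<in> V" for u
    by (rule tr_cong, rule iter_cong[where t = 1, simplified, of _ _ j])
      (use that tr_in in \<open>auto simp: tr_def\<close>)
  define \<Phi> where "\<Phi> u = tr (F u)" for u
  have "\<Phi> ` (tr ` V) = tr ` V"
  proof -
    have "\<Phi> ` (tr ` V) = tr ` (F ` V)"
      unfolding \<Phi>_def image_image by (intro image_cong refl tr_F)
    also have "F ` V = V" using bij by (rule bij_betw_imp_surj_on)
    finally show ?thesis .
  qed
  then have inj: "inj_on \<Phi> (tr ` V)"
    by (intro eq_card_imp_inj_on) auto
  \<comment> \<open>These points differ only in coordinate j, where F takes the values h and g + h
    modulo p; the two agree when p | g.\<close>
  define w1 where "w1 = (tr w)(j := 0)"
  define w2 where "w2 = (tr w)(j := 1)"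
  have w12: "w1 \<in> V" "w2 \<in> V" using j w tr_in p_gt_1 by (auto simp: w1_def w2_def intro!: Fp_vecs_upd)
  have "w1 = tr w1" "w2 = tr w2" using j by (auto simp: w1_def w2_def tr_def fun_eq_iff)
  then have mem: "w1 \<in> tr ` V" "w2 \<in> tr ` V" using w12 by auto
  have "\<Phi> w1 = \<Phi> w2"
    unfolding \<Phi>_def
  proof (rule tr_cong)
    fix i assume i: "i \<in> {j..m}"
    show "F w1 i = F w2 i"
    proof (cases "i = j")
      case True
      have g: "g j w1 = g j w" "g j w2 = g j w" and h: "h j w1 = h j w" "h j w2 = h j w"
        using j by (auto intro!: g_cong h_cong simp: w1_def w2_def tr_def)
      have "F w1 j = h j w mod int p" "F w2 j = (g j w + h j w) mod int p"
        using w12 j by (simp_all add: step g h) (simp_all add: w1_def w2_def)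
      then show ?thesis using dvd True by (simp add: mod_eq_dvd_iff)
    next
      case False
      then show ?thesis
        using i by (intro iter_cong[where t = 1, simplified, OF w12, of "Suc j"]) (auto simp: w1_def w2_def)
    qed
  qed
  then have "w1 = w2" using inj mem by (auto dest: inj_onD)
  then have "w1 j = w2 j" by simp
  then show False by (simp add: w1_def w2_def)
qed

definition G :: "nat \<Rightarrow> nat \<Rightarrow> (nat \<Rightarrow> int) \<Rightarrow> int" where
  "G j t w = (\<Prod>\<tau><t. g j ((F ^^ \<tau>) w))"

primrec K :: "nat \<Rightarrow> nat \<Rightarrow> (nat \<Rightarrow> int) \<Rightarrow> int" where
  "K j 0 w = 0"
| "K j (Suc t) w = K j t w * g j ((F ^^ t) w) + h j ((F ^^ t) w)"

lemma iter_affine: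
  assumes "w \<in> V" "j \<le> m"
  shows "[(F ^^ t) w j = w j * G j t w + K j t w] (mod int p)"
proof (induction t)
  case (Suc t)
  let ?g = "g j ((F ^^ t) w)" and ?h = "h j ((F ^^ t) w)"
  have "[(F ^^ Suc t) w j = (F ^^ t) w j * ?g + ?h] (mod int p)"
    using step[OF iter_in[OF assms(1)] assms(2)] by (simp add: Cong.cong_def)
  also have "[(F ^^ t) w j * ?g + ?h = (w j * G j t w + K j t w) * ?g + ?h] (mod int p)"
    using Suc by (intro cong_add cong_mult cong_refl)
  also have "(w j * G j t w + K j t w) * ?g + ?h = w j * G j (Suc t) w + K j (Suc t) w"
    by (simp add: G_def algebra_simps)
  finally show ?case .
qed (simp add: G_def)

lemma G_cong:
  assumes "w \<in> V" "w' \<in> V" "j \<le> m" "\<And>i. i \<in> {j<..m} \<Longrightarrow> w i = w' i"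
  shows "G j t w = G j t w'"
  unfolding G_def
proof (intro prod.cong refl g_cong assms)
  fix \<tau> i assume "i \<in> {j<..m}"
  then show "(F ^^ \<tau>) w i = (F ^^ \<tau>) w' i"
    using assms by (intro iter_cong[of _ _ "Suc j"]) auto
qed

lemma K_cong:
  assumes "w \<in> V" "w' \<in> V" "j \<le> m" "\<And>i. i \<in> {j<..m} \<Longrightarrow> w i = w' i"
  shows "K j t w = K j t w'"
proof (induction t)
  case (Suc t)
  have *: "(F ^^ t) w i = (F ^^ t) w' i" if "i \<in> {j<..m}" for i
    using assms that by (intro iter_cong[of _ _ "Suc j"]) auto
  have "g j ((F ^^ t) w) = g j ((F ^^ t) w')" "h j ((F ^^ t) w) = h j ((F ^^ t) w')"
    using assms(3) * by (auto intro!: g_cong h_cong)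
  then show ?case using Suc by simp
qed simp

lemma G_nonzero:
  assumes "j \<le> m" "w \<in> V"
  shows "\<not> int p dvd G j t w"
proof -
  have "Factorial_Ring.prime (int p)" using prime by simp
  then show ?thesis
    unfolding G_def using g_nonzero[OF assms(1) iter_in[OF assms(2)]]
    by (auto simp: prime_dvd_prod_iff)
qed

text \<open>Bijectivity of the iterate reduces the count to t = 0, where exactly one of the p values
  of coordinate l is zero.\<close>

lemma card_coord_zero:
  assumes "l \<le> m"
  shows "card {w \<in> V. (F ^^ t) w l = 0} = p ^ m"
proof -
  define \<phi> :: "(nat \<Rightarrow> int) \<Rightarrow> nat" where "\<phi> w = (if w l = 0 then 1 else 0)" for w
  have "card {w \<in> V. (F ^^ t) w l = 0} = (\<Sum>w\<in>V. \<phi> ((F ^^ t) w))"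
    by (simp add: \<phi>_def sum.If_cases Int_def)
  also have "\<dots> = (\<Sum>w\<in>V. \<phi> w)"
    by (rule sum.reindex_bij_betw[OF bij_iter])
  finally have 1: "card {w \<in> V. (F ^^ t) w l = 0} = (\<Sum>w\<in>V. \<phi> w)" .
  have "of_nat p * (\<Sum>w\<in>V. \<phi> w) = (\<Sum>w\<in>V. \<Sum>y\<in>{0..<int p}. \<phi> (w(l := y)))"
    by (rule sum_Fp_vecs_coord[OF assms, symmetric])
  also have "\<dots> = (\<Sum>w\<in>V. 1)"
    using p_pos by (intro sum.cong refl) (simp add: \<phi>_def sum.delta)
  also have "\<dots> = p * p ^ m" by (simp add: card_Fp_vecs)
  finally show ?thesis using 1 p_pos by simp
qed

text \<open>With the later coordinates fixed, coordinate i + 1 of each iterate is affine in y modulo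
  p, with slope prime to p. Substituting these affine forms into the polynomials \<open>c\<close>
  makes \<open>G i k\<close> a polynomial in y, and the claim becomes a count of roots.\<close>

lemma card_G_eq_1_fibre:
  assumes i: "i < m" and k: "k > 0" and w: "w \<in> V"
    and good: "\<And>t l. t < k \<Longrightarrow> l \<in> {Suc i<..m} \<Longrightarrow> (F ^^ t) w l \<noteq> 0"
  shows "card {y \<in> {0..<int p}. [G i k (w(Suc i := y)) = 1] (mod int p)} \<le> k * d"
proof -
  define j where "j = Suc i"
  have jm: "j \<le> m" using i by (simp add: j_def)
  have pint: "Factorial_Ring.prime (int p)" using prime by simp
  define C where "C t = c i ((F ^^ t) w)" for t
  define P where "P = (\<Prod>t<k. pcompose (C t) [:K j t w, G j t w:])"
  have Cd: "degree (C t) \<in> {1..d} \<and> \<not> int p dvd lead_coeff (C t)" if "t < k" for t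
    unfolding C_def using i iter_in[OF w] good[OF that] by (intro c_deg) auto
  have G0: "\<not> int p dvd G j t w" for t by (rule G_nonzero[OF jm w])
  have G0': "G j t w \<noteq> 0" for t using G0[of t] by auto
  have "P \<noteq> 0 \<and> degree P = (\<Sum>t<k. degree (C t)) \<and> \<not> int p dvd lead_coeff P"
  proof -
    \<comment> \<open>The leading coefficient of each factor is that of \<open>C t\<close> times a
      power of the slope, both units modulo p.\<close>
    have lead: "\<not> int p dvd lead_coeff (pcompose (C t) [:K j t w, G j t w:])" if "t < k" for t
    proof -
      have "lead_coeff (pcompose (C t) [:K j t w, G j t w:]) = lead_coeff (C t) * G j t w ^ degree (C t)"
        using G0'[of t] by (subst lead_coeff_comp) auto
      then show ?thesis
        using Cd[OF that] G0[of t] pint by (metis prime_dvd_mult_iff prime_dvd_power)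
    qed
    then have nz: "pcompose (C t) [:K j t w, G j t w:] \<noteq> 0" if "t < k" for t
      using that by force
    have "lead_coeff P = (\<Prod>t<k. lead_coeff (pcompose (C t) [:K j t w, G j t w:]))"
      unfolding P_def by (rule lead_coeff_prod)
    then have 1: "\<not> int p dvd lead_coeff P"
      using lead pint by (auto simp: prime_dvd_prod_iff)
    have "degree P = (\<Sum>t<k. degree (pcompose (C t) [:K j t w, G j t w:]))"
      unfolding P_def using nz by (intro degree_prod_sum_eq) auto
    also have "\<dots> = (\<Sum>t<k. degree (C t))"
      using G0' by (simp add: degree_pcompose)
    finally show ?thesis using 1 by auto
  qed
  then have P: "P \<noteq> 0" "degree P = (\<Sum>t<k. degree (C t))" "\<not> int p dvd lead_coeff P" by auto
  have "degree P \<le> (\<Sum>t<k. d)" unfolding P(2) using Cd by (intro sum_mono) auto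
  then have degle: "degree P \<le> k * d" by simp
  \<comment> \<open>The factor t = 0, present because k > 0, makes P nonconstant; hence subtracting
    1 changes neither degree nor leading coefficient.\<close>
  have "degree (C 0) \<le> degree P" unfolding P(2) using k by (intro member_le_sum) auto
  then have "degree P > 0" using Cd[OF k] by simp
  then have deg1: "degree (P - 1) = degree P" "lead_coeff (P - 1) = lead_coeff P"
  proof -
    show *: "degree (P - 1) = degree P"
      using \<open>degree P > 0\<close> degree_add_eq_left[of "- 1" P] by simp
    show "lead_coeff (P - 1) = lead_coeff P"
      unfolding * using \<open>degree P > 0\<close> by simp
  qed
  have Geq: "[G i k (w(j := y)) = poly P y] (mod int p)" if y: "y \<in> {0..<int p}" for y
    unfolding G_def[of i k] P_def poly_prod
  proof (intro cong_prod)
    fix t assume "t \<in> {..<k}"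
    let ?w = "w(j := y)"
    have w': "?w \<in> V" using w jm y by (rule Fp_vecs_upd)
    have "c i ((F ^^ t) ?w) = C t"
      unfolding C_def
    proof (rule c_cong[OF i])
      fix l assume "l \<in> {Suc i<..m}"
      then show "(F ^^ t) ?w l = (F ^^ t) w l"
        using w w' by (intro iter_cong[of _ _ "Suc j"]) (auto simp: j_def)
    qed
    then have "[g i ((F ^^ t) ?w) = poly (C t) ((F ^^ t) ?w j)] (mod int p)"
      using g_poly[OF i, of "(F ^^ t) ?w"] by (simp add: j_def)
    also have "[poly (C t) ((F ^^ t) ?w j) = poly (C t) (K j t w + y * G j t w)] (mod int p)"
    proof -
      have "G j t ?w = G j t w" "K j t ?w = K j t w"
        using w w' jm by (auto intro!: G_cong K_cong)
      then have "[(F ^^ t) ?w j = K j t w + y * G j t w] (mod int p)"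
        using iter_affine[OF w' jm, of t] by (simp add: add.commute)
      then show ?thesis
        by (simp add: poly_altdef cong_sum cong_mult cong_pow)
    qed
    finally show "[g i ((F ^^ t) ?w) = poly (pcompose (C t) [:K j t w, G j t w:]) y] (mod int p)"
      by (simp add: poly_pcompose)
  qed
  have eq: "{y \<in> {0..<int p}. [G i k (w(j := y)) = 1] (mod int p)} =
      {y \<in> {0..<int p}. int p dvd poly (P - 1) y}"
  proof (intro Collect_cong conj_cong refl)
    fix y assume "y \<in> {0..<int p}"
    then have "[G i k (w(j := y)) = 1] (mod int p) \<longleftrightarrow> [poly P y = 1] (mod int p)"
      using Geq[of y] by (auto intro: cong_trans cong_sym)
    then show "[G i k (w(j := y)) = 1] (mod int p) \<longleftrightarrow> int p dvd poly (P - 1) y"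
      by (simp add: cong_iff_dvd_diff)
  qed
  have "\<not> int p dvd lead_coeff (P - 1)"
    unfolding deg1(2) by (rule P(3))
  then have "card {y \<in> {0..<int p}. [G i k (w(j := y)) = 1] (mod int p)} \<le> degree (P - 1)"
    unfolding eq by (rule card_roots_mod_prime[OF prime])
  then show ?thesis using degle by (simp add: deg1 j_def)
qed

text \<open>Points whose orbit has a zero in some coordinate beyond i + 1 are discarded by a union
  bound, at a cost of k m p^m. The others are counted along lines in direction i + 1, with at most k
  d solutions on each.\<close>

lemma card_G_eq_1:
  assumes i: "i < m" and k: "k > 0"
  shows "card {w \<in> V. [G i k w = 1] (mod int p)} \<le> k * (m + d) * p ^ m"
proof -
  define bad where "bad w \<longleftrightarrow> (\<exists>t<k. \<exists>l\<in>{Suc i<..m}. (F ^^ t) w l = 0)" for w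
  define \<phi> :: "(nat \<Rightarrow> int) \<Rightarrow> nat" where
    "\<phi> w = (if \<not> bad w \<and> [G i k w = 1] (mod int p) then 1 else 0)" for w
  have "card {w \<in> V. bad w} \<le> card (\<Union>t<k. \<Union>l\<in>{Suc i<..m}. {w \<in> V. (F ^^ t) w l = 0})"
    by (intro card_mono) (auto simp: bad_def)
  also have "\<dots> \<le> (\<Sum>t<k. card (\<Union>l\<in>{Suc i<..m}. {w \<in> V. (F ^^ t) w l = 0}))"
    by (rule card_UN_le) simp
  also have "\<dots> \<le> (\<Sum>t<k. \<Sum>l\<in>{Suc i<..m}. card {w \<in> V. (F ^^ t) w l = 0})"
    by (intro sum_mono card_UN_le) simp
  also have "\<dots> = (\<Sum>t<k. \<Sum>l\<in>{Suc i<..m}. p ^ m)"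
    by (intro sum.cong refl card_coord_zero) auto
  also have "\<dots> = k * (m - Suc i) * p ^ m" by simp
  also have "\<dots> \<le> k * m * p ^ m" by simp
  finally have bad: "card {w \<in> V. bad w} \<le> k * m * p ^ m" .
  have "of_nat p * (\<Sum>w\<in>V. \<phi> w) = (\<Sum>w\<in>V. \<Sum>y\<in>{0..<int p}. \<phi> (w(Suc i := y)))"
    using i by (intro sum_Fp_vecs_coord[symmetric]) auto
  also have "\<dots> \<le> (\<Sum>w\<in>V. k * d)"
  proof (intro sum_mono)
    fix w assume w: "w \<in> V"
    \<comment> \<open>Badness involves only coordinates beyond i + 1, so it is constant along each
      line.\<close>
    have bad_iff: "bad (w(Suc i := y)) \<longleftrightarrow> bad w" if "y \<in> {0..<int p}" for y
    proof -
      have "(F ^^ t) (w(Suc i := y)) l = (F ^^ t) w l" if "l \<in> {Suc i<..m}" for t l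
        using that w i Fp_vecs_upd[OF w _ \<open>y \<in> {0..<int p}\<close>, of "Suc i"]
        by (intro iter_cong[of _ _ "Suc (Suc i)"]) auto
      then show ?thesis by (simp add: bad_def)
    qed
    show "(\<Sum>y\<in>{0..<int p}. \<phi> (w(Suc i := y))) \<le> k * d"
    proof (cases "bad w")
      case True
      then show ?thesis by (simp add: \<phi>_def bad_iff)
    next
      case False
      have "(\<Sum>y\<in>{0..<int p}. \<phi> (w(Suc i := y))) =
          card {y \<in> {0..<int p}. [G i k (w(Suc i := y)) = 1] (mod int p)}"
        using False by (simp add: \<phi>_def bad_iff sum.If_cases Int_def)
      also have "\<dots> \<le> k * d"
        using False by (intro card_G_eq_1_fibre[OF i k w]) (auto simp: bad_def)
      finally show ?thesis .
    qed
  qed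
  also have "\<dots> = p * (k * d * p ^ m)" by (simp add: card_Fp_vecs)
  finally have "(\<Sum>w\<in>V. \<phi> w) \<le> k * d * p ^ m" using p_pos by simp
  moreover have "(\<Sum>w\<in>V. \<phi> w) = card {w \<in> V. \<not> bad w \<and> [G i k w = 1] (mod int p)}"
    by (simp add: \<phi>_def sum.If_cases Int_def)
  ultimately have good: "card {w \<in> V. \<not> bad w \<and> [G i k w = 1] (mod int p)} \<le> k * d * p ^ m" by simp
  have "card {w \<in> V. [G i k w = 1] (mod int p)} \<le>
      card ({w \<in> V. bad w} \<union> {w \<in> V. \<not> bad w \<and> [G i k w = 1] (mod int p)})"
    by (intro card_mono) auto
  also have "\<dots> \<le> card {w \<in> V. bad w} + card {w \<in> V. \<not> bad w \<and> [G i k w = 1] (mod int p)}"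
    by (rule card_Un_le)
  also have "\<dots> \<le> k * (m + d) * p ^ m"
    using bad good by (simp add: algebra_simps)
  finally show ?thesis .
qed

end

section \<open>Mean squares of exponential sums along orbits\<close>

context triangular_map
begin

definition freqs :: "(nat \<Rightarrow> int) set" where
  "freqs = PiE {..<m} (\<lambda>_. {0..<int p}) - {\<lambda>j\<in>{..<m}. 0}"

definition orb :: "(nat \<Rightarrow> int) \<Rightarrow> nat \<Rightarrow> (nat \<Rightarrow> int) \<Rightarrow> complex" where
  "orb a n v = ep p (\<Sum>j<m. a j * (F ^^ n) v j)"

lemma norm_sum_shift_le:
  assumes a: "a \<in> freqs" and k: "k > 0"
  shows "cmod (\<Sum>w\<in>V. ep p (\<Sum>j<m. a j * ((F ^^ k) w j - w j))) \<le> real (k * (m + d) * p ^ m)"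
proof -
  have "\<exists>i. i < m \<and> a i \<noteq> 0"
  proof (rule ccontr)
    assume "\<not> ?thesis"
    then have "a = (\<lambda>j\<in>{..<m}. 0)"
      using a by (auto simp: freqs_def PiE_def extensional_def fun_eq_iff)
    then show False using a by (simp add: freqs_def)
  qed
  then obtain i where i: "i < m" "a i \<noteq> 0" and min: "\<And>l. l < i \<Longrightarrow> \<not> (l < m \<and> a l \<noteq> 0)"
    unfolding exists_least_iff[of "\<lambda>i. i < m \<and> a i \<noteq> 0"] by blast
  have least: "a l = 0" if "l < i" for l using min[OF that] that i(1) by simp
  have "a i \<in> {0..<int p}" using a i by (auto simp: freqs_def PiE_def Pi_def)
  then have ai: "\<not> int p dvd a i" using i(2) zdvd_not_zless[of "a i" "int p"] by auto
  have pint: "Factorial_Ring.prime (int p)" using prime by simp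
  define \<phi> where "\<phi> w = ep p (\<Sum>j<m. a j * ((F ^^ k) w j - w j))" for w
  \<comment> \<open>Earlier coordinates carry zero frequency and later ones do not see
    \<open>w i\<close>, so along the line the phase is linear in y with coefficient a_i (G - 1). The
    complete sum vanishes unless G = 1 modulo p.\<close>
  have inner: "cmod (\<Sum>y\<in>{0..<int p}. \<phi> (w(i := y))) \<le> (if [G i k w = 1] (mod int p) then real p else 0)"
    if w: "w \<in> V" for w
  proof -
    define R where "R = (\<Sum>j\<in>{i<..<m}. a j * ((F ^^ k) w j - w j))"
    have "\<phi> (w(i := y)) = ep p (a i * (G i k w - 1) * y) * ep p (a i * K i k w + R)"
      if y: "y \<in> {0..<int p}" for y
    proof -
      let ?w = "w(i := y)"
      have w': "?w \<in> V" using w i y by (intro Fp_vecs_upd) auto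
      have "(\<Sum>j<m. a j * ((F ^^ k) ?w j - ?w j)) = (\<Sum>j\<in>{i..<m}. a j * ((F ^^ k) ?w j - ?w j))"
        using least by (intro sum.mono_neutral_right) auto
      also have "{i..<m} = insert i {i<..<m}" using i by auto
      also have "(\<Sum>j\<in>insert i {i<..<m}. a j * ((F ^^ k) ?w j - ?w j)) =
          a i * ((F ^^ k) ?w i - y) + (\<Sum>j\<in>{i<..<m}. a j * ((F ^^ k) ?w j - ?w j))"
        by simp
      also have "(\<Sum>j\<in>{i<..<m}. a j * ((F ^^ k) ?w j - ?w j)) = R"
        unfolding R_def
      proof (intro sum.cong refl)
        fix j assume j: "j \<in> {i<..<m}"
        have "(F ^^ k) ?w j = (F ^^ k) w j"
          using w w' j by (intro iter_cong[of _ _ "Suc i"]) auto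
        then show "a j * ((F ^^ k) ?w j - ?w j) = a j * ((F ^^ k) w j - w j)"
          using j by simp
      qed
      finally have 1: "(\<Sum>j<m. a j * ((F ^^ k) ?w j - ?w j)) = a i * ((F ^^ k) ?w i - y) + R" .
      have "G i k ?w = G i k w" "K i k ?w = K i k w"
        using w w' i by (auto intro!: G_cong K_cong)
      then have "[(F ^^ k) ?w i = y * G i k w + K i k w] (mod int p)"
        using iter_affine[OF w', of i k] i by simp
      then have "[a i * ((F ^^ k) ?w i - y) + R = a i * ((y * G i k w + K i k w) - y) + R] (mod int p)"
        by (intro cong_add cong_mult cong_diff cong_refl)
      also have "a i * ((y * G i k w + K i k w) - y) + R =
          a i * (G i k w - 1) * y + (a i * K i k w + R)"
        by (simp add: algebra_simps)
      finally have "\<phi> ?w = ep p (a i * (G i k w - 1) * y + (a i * K i k w + R))"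
        unfolding \<phi>_def 1 by (rule ep_cong[OF p_pos])
      then show ?thesis by (simp only: ep_add)
    qed
    then have "(\<Sum>y\<in>{0..<int p}. \<phi> (w(i := y))) =
        (\<Sum>y\<in>{0..<int p}. ep p (a i * (G i k w - 1) * y)) * ep p (a i * K i k w + R)"
      by (simp add: sum_distrib_right)
    then have "cmod (\<Sum>y\<in>{0..<int p}. \<phi> (w(i := y))) =
        (if int p dvd a i * (G i k w - 1) then real p else 0)"
      by (simp add: norm_mult sum_ep_complete[OF p_pos])
    also have "int p dvd a i * (G i k w - 1) \<longleftrightarrow> [G i k w = 1] (mod int p)"
      using ai pint by (simp add: prime_dvd_mult_iff cong_iff_dvd_diff)
    finally show ?thesis by (rule eq_refl)
  qed
  have "real p * cmod (\<Sum>w\<in>V. \<phi> w) = cmod (of_nat p * (\<Sum>w\<in>V. \<phi> w))"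
    by (simp add: norm_mult)
  also have "of_nat p * (\<Sum>w\<in>V. \<phi> w) = (\<Sum>w\<in>V. \<Sum>y\<in>{0..<int p}. \<phi> (w(i := y)))"
    using i by (intro sum_Fp_vecs_coord[symmetric]) auto
  also have "cmod \<dots> \<le> (\<Sum>w\<in>V. if [G i k w = 1] (mod int p) then real p else 0)"
    by (intro sum_norm_le inner)
  also have "\<dots> = real p * real (card {w \<in> V. [G i k w = 1] (mod int p)})"
    by (simp add: sum.If_cases Int_def)
  finally have "cmod (\<Sum>w\<in>V. \<phi> w) \<le> real (card {w \<in> V. [G i k w = 1] (mod int p)})"
    using p_pos by simp
  also have "\<dots> \<le> real (k * (m + d) * p ^ m)"
    using card_G_eq_1[OF i(1) k] by (rule of_nat_mono)
  finally show ?thesis by (simp add: \<phi>_def)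
qed

text \<open>Substituting w = F^n v, a bijection of \<open>V\<close>, leaves only the time lag n' -
  n.\<close>

lemma norm_correlation_le:
  assumes a: "a \<in> freqs" and n: "n < n'"
  shows "cmod (\<Sum>v\<in>V. orb a n' v * cnj (orb a n v)) \<le> real ((n' - n) * (m + d) * p ^ m)"
proof -
  have "orb a n' v * cnj (orb a n v) =
      ep p (\<Sum>j<m. a j * ((F ^^ (n' - n)) ((F ^^ n) v) j - (F ^^ n) v j))" for v
  proof -
    have "(F ^^ n') v = (F ^^ (n' - n)) ((F ^^ n) v)"
      using n funpow_add[of "n' - n" n F] by simp
    then show ?thesis
      by (simp add: orb_def right_diff_distrib sum_subtractf ep_diff)
  qed
  then have "(\<Sum>v\<in>V. orb a n' v * cnj (orb a n v)) =
      (\<Sum>v\<in>V. ep p (\<Sum>j<m. a j * ((F ^^ (n' - n)) ((F ^^ n) v) j - (F ^^ n) v j)))"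
    by simp
  also have "\<dots> = (\<Sum>w\<in>V. ep p (\<Sum>j<m. a j * ((F ^^ (n' - n)) w j - w j)))"
    by (rule sum.reindex_bij_betw[OF bij_iter, of "\<lambda>w. ep p (\<Sum>j<m. a j * ((F ^^ (n' - n)) w j - w j))"])
  finally show ?thesis using norm_sum_shift_le[OF a, of "n' - n"] n by simp
qed

text \<open>Expanding the square gives L diagonal terms of size p^(m+1) and at most L^2
  correlations, each with a lag of at most L. The cubic term stays of the order of the first as long
  as L^2 <= p.\<close>

lemma mean_square_short:
  assumes a: "a \<in> freqs"
  shows "(\<Sum>v\<in>V. (cmod (\<Sum>n\<in>{x..<x + L}. orb a n v))\<^sup>2)
    \<le> real p ^ m * (real L * real p + real L ^ 3 * real (m + d))"
proof -
  define I where "I = {x..<x + L}"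
  have card_I: "card I = L" "finite I" by (auto simp: I_def)
  have bound: "cmod (\<Sum>v\<in>V. orb a n v * cnj (orb a n' v)) \<le>
      (if n = n' then real p ^ (m + 1) else 0) + real L * real (m + d) * real p ^ m"
    if "n \<in> I" "n' \<in> I" for n n'
  proof -
    have le: "real (k * (m + d) * p ^ m) \<le> real L * real (m + d) * real p ^ m" if "k \<le> L" for k
    proof -
      have "k * (m + d) * p ^ m \<le> L * (m + d) * p ^ m" using that by (intro mult_right_mono) auto
      then have "real (k * (m + d) * p ^ m) \<le> real (L * (m + d) * p ^ m)" by (rule of_nat_mono)
      then show ?thesis by simp
    qed
    consider "n = n'" | "n < n'" | "n' < n" by linarith
    then show ?thesis
    proof cases
      case 1
      have "cmod (\<Sum>v\<in>V. orb a n v * cnj (orb a n' v)) \<le> (\<Sum>v\<in>V. 1)"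
        by (intro sum_norm_le) (simp add: orb_def norm_mult)
      then show ?thesis using 1 by (simp add: card_Fp_vecs add_increasing2)
    next
      case 2
      have "(\<Sum>v\<in>V. orb a n v * cnj (orb a n' v)) = cnj (\<Sum>v\<in>V. orb a n' v * cnj (orb a n v))"
        by (simp add: mult.commute)
      then have "cmod (\<Sum>v\<in>V. orb a n v * cnj (orb a n' v)) \<le> real ((n' - n) * (m + d) * p ^ m)"
        using norm_correlation_le[OF a 2] by (simp only: complex_mod_cnj)
      also have "\<dots> \<le> real L * real (m + d) * real p ^ m"
        using that by (intro le) (auto simp: I_def)
      finally show ?thesis using 2 by simp
    next
      case 3
      have "cmod (\<Sum>v\<in>V. orb a n v * cnj (orb a n' v)) \<le> real ((n - n') * (m + d) * p ^ m)"
        by (rule norm_correlation_le[OF a 3])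
      also have "\<dots> \<le> real L * real (m + d) * real p ^ m"
        using that by (intro le) (auto simp: I_def)
      finally show ?thesis using 3 by simp
    qed
  qed
  have "complex_of_real (\<Sum>v\<in>V. (cmod (\<Sum>n\<in>I. orb a n v))\<^sup>2) =
      (\<Sum>v\<in>V. (\<Sum>n\<in>I. orb a n v) * cnj (\<Sum>n\<in>I. orb a n v))"
    by (simp only: complex_norm_square of_real_sum)
  also have "\<dots> = (\<Sum>v\<in>V. \<Sum>n\<in>I. \<Sum>n'\<in>I. orb a n v * cnj (orb a n' v))"
    by (simp only: sum_product cnj_sum)
  also have "\<dots> = (\<Sum>n\<in>I. \<Sum>v\<in>V. \<Sum>n'\<in>I. orb a n v * cnj (orb a n' v))"
    by (rule sum.swap)
  also have "\<dots> = (\<Sum>n\<in>I. \<Sum>n'\<in>I. \<Sum>v\<in>V. orb a n v * cnj (orb a n' v))"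
    by (intro sum.cong refl sum.swap)
  finally have "complex_of_real (\<Sum>v\<in>V. (cmod (\<Sum>n\<in>I. orb a n v))\<^sup>2) =
      (\<Sum>n\<in>I. \<Sum>n'\<in>I. \<Sum>v\<in>V. orb a n v * cnj (orb a n' v))" .
  from arg_cong[OF this, of cmod] have "\<bar>\<Sum>v\<in>V. (cmod (\<Sum>n\<in>I. orb a n v))\<^sup>2\<bar> =
      cmod (\<Sum>n\<in>I. \<Sum>n'\<in>I. \<Sum>v\<in>V. orb a n v * cnj (orb a n' v))"
    by (simp only: norm_of_real)
  also have "\<dots> \<le> (\<Sum>n\<in>I. \<Sum>n'\<in>I. (if n = n' then real p ^ (m + 1) else 0) + real L * real (m + d) * real p ^ m)"
    using bound by (intro sum_norm_le) auto
  also have "\<dots> = real L * real p ^ (m + 1) + real L * (real L * (real L * real (m + d) * real p ^ m))"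
    by (simp add: sum.distrib card_I algebra_simps)
  also have "\<dots> = real p ^ m * (real L * real p + real L ^ 3 * real (m + d))"
    by (simp add: algebra_simps power3_eq_cube)
  finally show ?thesis by (simp add: I_def)
qed

end

section \<open>Mean squares over blocks of arbitrary dyadic length\<close>

lemma sum_blocks:
  fixes f :: "nat \<Rightarrow> 'a :: comm_monoid_add"
  shows "(\<Sum>b<q. \<Sum>n\<in>{x + b * Q..<x + b * Q + Q}. f n) = (\<Sum>n\<in>{x..<x + q * Q}. f n)"
proof (induction q)
  case (Suc q)
  have "(\<Sum>n\<in>{x..<x + Suc q * Q}. f n) =
      (\<Sum>n\<in>{x..<x + q * Q}. f n) + (\<Sum>n\<in>{x + q * Q..<x + q * Q + Q}. f n)"
    by (subst sum.atLeastLessThan_concat) (auto simp: algebra_simps)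
  then show ?case using Suc by simp
qed simp

lemma norm_sum_square_le:
  fixes f :: "'i \<Rightarrow> 'a :: real_normed_vector"
  shows "(norm (\<Sum>i\<in>I. f i))\<^sup>2 \<le> real (card I) * (\<Sum>i\<in>I. (norm (f i))\<^sup>2)"
proof -
  have "(norm (\<Sum>i\<in>I. f i))\<^sup>2 \<le> (\<Sum>i\<in>I. 1 * norm (f i))\<^sup>2"
    using norm_sum[of f I] by (intro power_mono) auto
  also have "\<dots> \<le> (\<Sum>i\<in>I. 1\<^sup>2) * (\<Sum>i\<in>I. (norm (f i))\<^sup>2)"
    by (rule Cauchy_Schwarz_ineq_sum)
  finally show ?thesis by simp
qed

context triangular_map
begin

lemma mean_square:
  assumes a: "a \<in> freqs"
  shows "(\<Sum>v\<in>V. (cmod (\<Sum>n\<in>{x..<x + 2 ^ l}. orb a n v))\<^sup>2)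
    \<le> 2 * real (1 + m + d) * real p ^ (m + 1) * (2 ^ l + (2 ^ l)\<^sup>2 / sqrt (real p))"
proof -
  define C where "C = real (1 + m + d) * real p ^ (m + 1)"
  have C0: "C \<ge> 0" by (simp add: C_def)
  have short: "(\<Sum>v\<in>V. (cmod (\<Sum>n\<in>{x..<x + L}. orb a n v))\<^sup>2) \<le> C * real L" if "L\<^sup>2 \<le> p" for L x
  proof -
    have "real (L\<^sup>2) \<le> real p" using that by (rule of_nat_mono)
    then have "real L * (real L)\<^sup>2 * real (m + d) \<le> real L * real p * real (m + d)"
      by (intro mult_right_mono mult_left_mono) auto
    then have "real p ^ m * (real L * real p + real L ^ 3 * real (m + d)) \<le>
        real p ^ m * (real L * real p + real L * real p * real (m + d))"
      by (intro mult_left_mono add_left_mono) (auto simp: power2_eq_square power3_eq_cube)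
    also have "\<dots> = C * real L" by (simp add: C_def algebra_simps)
    finally show ?thesis using mean_square_short[OF a, of x L] by linarith
  qed
  have "(\<Sum>v\<in>V. (cmod (\<Sum>n\<in>{x..<x + 2 ^ l}. orb a n v))\<^sup>2) \<le>
      C * (2 * (2 ^ l + (2 ^ l)\<^sup>2 / sqrt (real p)))"
  proof (cases "(2 ^ l)\<^sup>2 \<le> p")
    case True
    have "C * 2 ^ l \<le> C * (2 * (2 ^ l + (2 ^ l)\<^sup>2 / sqrt (real p)))"
      using C0 by (intro mult_left_mono) (auto intro!: add_increasing2)
    then show ?thesis using short[OF True, of x] by simp
  next
    case False
    \<comment> \<open>A long sum is cut into 2^r blocks of length 2^q, the largest power of two not
      exceeding sqrt p. Cauchy-Schwarz costs the number of blocks, giving C 2^(2r + q) = C 2^(2l) /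
      2^q, and maximality of q gives 2^q >= sqrt p / 2.\<close>
    define q where "q = (GREATEST q. (2 ^ q)\<^sup>2 \<le> p)"
    have bnd: "q \<le> l" if "(2 ^ q)\<^sup>2 \<le> p" for q
    proof (rule ccontr)
      assume "\<not> q \<le> l"
      then have "(2 ^ l :: nat)\<^sup>2 \<le> (2 ^ q)\<^sup>2" by (intro power_mono power_increasing) auto
      then show False using that False by linarith
    qed
    have q: "(2 ^ q)\<^sup>2 \<le> p"
      unfolding q_def by (rule GreatestI_nat[of _ 0 l]) (use bnd p_pos in auto)
    have "\<not> (2 ^ Suc q)\<^sup>2 \<le> p"
      using Greatest_le_nat[of "\<lambda>q. (2 ^ q)\<^sup>2 \<le> p" "Suc q" l] bnd by (auto simp: q_def)
    then have "real p \<le> real ((2 ^ Suc q)\<^sup>2)" by (intro of_nat_mono) auto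
    then have sq: "sqrt (real p) \<le> 2 * 2 ^ q" by (intro real_le_lsqrt) auto
    define r where "r = l - q"
    have l: "2 ^ l = 2 ^ r * (2 ^ q :: nat)" using bnd[OF q] by (simp add: r_def flip: power_add)
    have lr: "2 ^ l = 2 ^ r * (2 ^ q :: real)" using bnd[OF q] by (simp add: r_def flip: power_add)
    have "(\<Sum>v\<in>V. (cmod (\<Sum>n\<in>{x..<x + 2 ^ l}. orb a n v))\<^sup>2) \<le>
        (\<Sum>v\<in>V. 2 ^ r * (\<Sum>b<2 ^ r. (cmod (\<Sum>n\<in>{x + b * 2 ^ q..<x + b * 2 ^ q + 2 ^ q}. orb a n v))\<^sup>2))"
    proof (intro sum_mono)
      fix v assume "v \<in> V"
      have eq: "(\<Sum>n\<in>{x..<x + 2 ^ l}. orb a n v) =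
          (\<Sum>b<2 ^ r. \<Sum>n\<in>{x + b * 2 ^ q..<x + b * 2 ^ q + 2 ^ q}. orb a n v)"
        unfolding l by (rule sum_blocks[symmetric])
      show "(cmod (\<Sum>n\<in>{x..<x + 2 ^ l}. orb a n v))\<^sup>2 \<le>
          2 ^ r * (\<Sum>b<2 ^ r. (cmod (\<Sum>n\<in>{x + b * 2 ^ q..<x + b * 2 ^ q + 2 ^ q}. orb a n v))\<^sup>2)"
        unfolding eq by (rule order_trans[OF norm_sum_square_le]) simp
    qed
    also have "\<dots> = 2 ^ r * (\<Sum>b<2 ^ r. \<Sum>v\<in>V. (cmod (\<Sum>n\<in>{x + b * 2 ^ q..<x + b * 2 ^ q + 2 ^ q}. orb a n v))\<^sup>2)"
      unfolding sum_distrib_left[symmetric] by (subst sum.swap) simp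
    also have "\<dots> \<le> 2 ^ r * (\<Sum>b<(2::nat) ^ r. C * real (2 ^ q))"
      by (intro mult_left_mono sum_mono short q) auto
    also have "\<dots> = C * (2 ^ r * 2 ^ r * 2 ^ q)" by simp
    also have "\<dots> \<le> C * (2 * ((2 ^ l)\<^sup>2 / sqrt (real p)))"
    proof (intro mult_left_mono C0)
      have "2 ^ r * 2 ^ r * 2 ^ q * sqrt (real p) \<le> 2 ^ r * 2 ^ r * 2 ^ q * (2 * 2 ^ q)"
        using sq by (intro mult_left_mono) auto
      also have "\<dots> = 2 * (2 ^ l)\<^sup>2" by (simp add: lr power2_eq_square)
      finally show "2 ^ r * 2 ^ r * 2 ^ q \<le> 2 * ((2 ^ l)\<^sup>2 / sqrt (real p))"
        using p_pos by (simp add: field_simps)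
    qed
    also have "\<dots> \<le> C * (2 * (2 ^ l + (2 ^ l)\<^sup>2 / sqrt (real p)))"
      using C0 by (intro mult_left_mono) auto
    finally show ?thesis .
  qed
  then show ?thesis by (simp only: C_def mult_ac)
qed

end

section \<open>Maximal sums and exceptional initial values\<close>

context triangular_map
begin

text \<open>The bound of \<open>norm_prefix_sum_le_dyadic\<close>, which dominates the sums over n <
  N for all N < 2^J at once.\<close>

definition maximal :: "(nat \<Rightarrow> int) \<Rightarrow> nat \<Rightarrow> (nat \<Rightarrow> int) \<Rightarrow> real" where
  "maximal a J v =
     (\<Sum>l<J. sqrt (\<Sum>b<2 ^ (J - l). (cmod (\<Sum>n\<in>{b * 2 ^ l..<b * 2 ^ l + 2 ^ l}. orb a n v))\<^sup>2))"

text \<open>Root mean square bound common to all dyadic levels, with the factor p^(m+1) of the sum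
  over \<open>V\<close> removed.\<close>

definition spread :: "nat \<Rightarrow> real" where
  "spread J = sqrt (2 * real (1 + m + d) * (2 ^ J + (2 ^ J)\<^sup>2 / sqrt (real p)))"

text \<open>Level l has 2^(J - l) blocks, so by \<open>mean_square\<close> its mean square is at
  most a constant times 2^J + 2^(J + l) / sqrt p, and 2^l <= 2^J. Cauchy-Schwarz over
  \<open>V\<close> passes from mean square to mean, and the J levels are added.\<close>

lemma sum_maximal_le:
  assumes a: "a \<in> freqs"
  shows "(\<Sum>v\<in>V. maximal a J v) \<le> real J * spread J * real p ^ (m + 1)"
proof -
  define X where "X l v = (\<Sum>b<2 ^ (J - l). (cmod (\<Sum>n\<in>{b * 2 ^ l..<b * 2 ^ l + 2 ^ l}. orb a n v))\<^sup>2)" for l v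
  define c where "c = 2 * real (1 + m + d) * real p ^ (m + 1)"
  have c: "c \<ge> 0" by (simp add: c_def)
  have X0: "X l v \<ge> 0" for l v by (simp add: X_def sum_nonneg)
  have "(\<Sum>v\<in>V. sqrt (X l v)) \<le> spread J * real p ^ (m + 1)" if "l < J" for l
  proof -
    have J: "2 ^ (J - l) * 2 ^ l = (2 ^ J :: real)" using that by (simp flip: power_add)
    have "(\<Sum>v\<in>V. X l v) = (\<Sum>b<2 ^ (J - l). \<Sum>v\<in>V. (cmod (\<Sum>n\<in>{b * 2 ^ l..<b * 2 ^ l + 2 ^ l}. orb a n v))\<^sup>2)"
      unfolding X_def by (rule sum.swap)
    also have "\<dots> \<le> (\<Sum>b<(2::nat) ^ (J - l). c * (2 ^ l + (2 ^ l)\<^sup>2 / sqrt (real p)))"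
      unfolding c_def by (intro sum_mono mean_square[OF a])
    also have "\<dots> = c * (2 ^ (J - l) * 2 ^ l + 2 ^ (J - l) * 2 ^ l * 2 ^ l / sqrt (real p))"
      by (simp add: power2_eq_square algebra_simps)
    also have "\<dots> \<le> c * (2 ^ J + (2 ^ J)\<^sup>2 / sqrt (real p))"
      unfolding J using that
      by (intro mult_left_mono c add_left_mono divide_right_mono)
        (auto simp: power2_eq_square power_increasing)
    finally have *: "(\<Sum>v\<in>V. X l v) \<le> c * (2 ^ J + (2 ^ J)\<^sup>2 / sqrt (real p))" .
    have "(\<Sum>v\<in>V. sqrt (X l v)) \<le> sqrt (real (card V) * (\<Sum>v\<in>V. X l v))"
      using X0 by (rule sum_sqrt_le)
    also have "\<dots> \<le> sqrt (real p ^ (m + 1) * (c * (2 ^ J + (2 ^ J)\<^sup>2 / sqrt (real p))))"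
      unfolding card_Fp_vecs of_nat_power by (intro real_sqrt_le_mono mult_left_mono *) auto
    also have "\<dots> = sqrt ((2 * real (1 + m + d) * (2 ^ J + (2 ^ J)\<^sup>2 / sqrt (real p))) * (real p ^ (m + 1))\<^sup>2)"
      by (rule arg_cong[where f = sqrt]) (simp only: c_def power2_eq_square mult_ac)
    also have "\<dots> = spread J * real p ^ (m + 1)"
      by (simp only: real_sqrt_mult spread_def real_sqrt_abs) simp
    finally show ?thesis .
  qed
  then have "(\<Sum>l<J. \<Sum>v\<in>V. sqrt (X l v)) \<le> (\<Sum>l<J. spread J * real p ^ (m + 1))"
    by (intro sum_mono) auto
  moreover have "(\<Sum>v\<in>V. maximal a J v) = (\<Sum>l<J. \<Sum>v\<in>V. sqrt (X l v))"
    unfolding maximal_def X_def[symmetric] by (rule sum.swap)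
  ultimately show ?thesis by simp
qed

text \<open>A frequency cutoff of 2^J, comparable with N in the application, makes the weights sum
  to O(J^m); a cutoff of order p would produce powers of log p instead of log N.\<close>

definition weighted_maximal :: "nat \<Rightarrow> (nat \<Rightarrow> int) \<Rightarrow> real" where
  "weighted_maximal J v = (\<Sum>a\<in>freqs. (\<Prod>j<m. freq_weight p (2 ^ J) (a j)) * maximal a J v)"

lemma prod_freq_weight_nonneg:
  assumes "a \<in> PiE {..<m} (\<lambda>_. {0..<int p})"
  shows "(\<Prod>j<m. freq_weight p H (a j)) \<ge> 0"
proof (intro prod_nonneg freq_weight_nonneg p_pos)
  fix j assume "j \<in> {..<m}"
  then show "a j \<in> {0..<int p}" using assms by (auto simp: PiE_def Pi_def)
qed

lemma weighted_exp_sum_le_weighted_maximal: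
  assumes "N < 2 ^ J"
  shows "weighted_exp_sum p m (2 ^ J) (\<lambda>n j. (F ^^ n) v j) N \<le> weighted_maximal J v"
  unfolding weighted_exp_sum_def weighted_maximal_def freqs_def[symmetric]
proof (intro sum_mono mult_left_mono)
  fix a assume "a \<in> freqs"
  then show "(\<Prod>j<m. freq_weight p (2 ^ J) (a j)) \<ge> 0" by (auto simp: freqs_def intro!: prod_freq_weight_nonneg)
  show "cmod (\<Sum>n<N. ep p (\<Sum>j<m. a j * (F ^^ n) v j)) \<le> maximal a J v"
    using norm_prefix_sum_le_dyadic[OF assms, of "\<lambda>n. orb a n v"]
    by (simp only: orb_def maximal_def)
qed

lemma spread_pos: "spread J > 0"
  unfolding spread_def real_sqrt_gt_0_iff
  by (intro mult_pos_pos add_pos_nonneg) auto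

lemma sum_weighted_maximal_le:
  assumes "J > 0"
  shows "(\<Sum>v\<in>V. weighted_maximal J v) \<le> (26 * real J) ^ m * (real J * spread J) * real p ^ (m + 1)"
proof -
  let ?P = "PiE {..<m} (\<lambda>_. {0..<int p})"
  define R where "R = real J * spread J * real p ^ (m + 1)"
  have R: "R \<ge> 0" using spread_pos[of J] by (simp add: R_def)
  have "(\<Sum>v\<in>V. weighted_maximal J v) = (\<Sum>a\<in>freqs. (\<Prod>j<m. freq_weight p (2 ^ J) (a j)) * (\<Sum>v\<in>V. maximal a J v))"
    unfolding weighted_maximal_def sum_distrib_left by (rule sum.swap)
  also have "\<dots> \<le> (\<Sum>a\<in>freqs. (\<Prod>j<m. freq_weight p (2 ^ J) (a j)) * R)"
    unfolding R_def by (intro sum_mono mult_left_mono sum_maximal_le prod_freq_weight_nonneg)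
      (auto simp: freqs_def)
  \<comment> \<open>Putting the zero frequency back only increases the sum and lets it factor over
    the coordinates.\<close>
  also have "\<dots> \<le> (\<Sum>a\<in>?P. (\<Prod>j<m. freq_weight p (2 ^ J) (a j)) * R)"
    using R by (intro sum_mono2) (auto simp: freqs_def finite_PiE intro!: mult_nonneg_nonneg prod_freq_weight_nonneg)
  also have "\<dots> = (\<Sum>a\<in>{0..<int p}. freq_weight p (2 ^ J) a) ^ m * R"
    using prod_sum_PiE[of "{..<m}" "\<lambda>_. {0..<int p}" "\<lambda>_. freq_weight p (2 ^ J)"]
    by (simp add: sum_distrib_right[symmetric])
  also have "\<dots> \<le> (26 * real J) ^ m * R"
  proof (intro mult_right_mono R power_mono sum_nonneg)
    \<comment> \<open>The constant 26 is 18 + 8, by ln 2 <= 1 and J >= 1.\<close>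
    have "ln (2::real) \<le> 1" using ln_le_minus_one[of 2] by simp
    then have "real J * ln 2 \<le> real J" by (simp add: mult_left_le)
    moreover have "ln (real (2 ^ J)) = real J * ln 2" by (simp add: ln_realpow)
    moreover have "1 \<le> real J" using assms by simp
    ultimately have "18 + 8 * ln (real (2 ^ J)) \<le> 26 * real J" by linarith
    then show "(\<Sum>a\<in>{0..<int p}. freq_weight p (2 ^ J) a) \<le> 26 * real J"
      using sum_freq_weight_le[OF p_pos, of "2 ^ J"] by simp
  qed (use p_pos in \<open>auto intro: freq_weight_nonneg\<close>)
  finally show ?thesis by (simp add: R_def mult_ac)
qed

text \<open>The threshold is the bound on the mean multiplied by ln p / \<epsilon>. By Markov's
  inequality one scale J then loses at most a proportion \<epsilon> / ln p of the initial values,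
  which leaves room for O(ln p) scales.\<close>

definition exceptional :: "real \<Rightarrow> nat \<Rightarrow> (nat \<Rightarrow> int) set" where
  "exceptional \<epsilon> J =
     {v \<in> V. weighted_maximal J v > (26 * real J) ^ m * (real J * spread J) * (ln (real p) / \<epsilon>)}"

lemma card_exceptional_le:
  assumes J: "J > 0" and \<epsilon>: "\<epsilon> > 0"
  shows "real (card (exceptional \<epsilon> J)) \<le> \<epsilon> * real p ^ (m + 1) / ln (real p)"
proof -
  define W where "W = (26 * real J) ^ m * (real J * spread J)"
  have W: "W > 0" using J spread_pos by (simp add: W_def)
  have lnp: "ln (real p) > 0" using p_gt_1 by simp
  have nn: "weighted_maximal J v \<ge> 0" for v
    unfolding weighted_maximal_def
  proof (rule sum_nonneg)
    fix a assume "a \<in> freqs"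
    then have "(\<Prod>j<m. freq_weight p (2 ^ J) (a j)) \<ge> 0"
      by (intro prod_freq_weight_nonneg) (simp add: freqs_def)
    moreover have "maximal a J v \<ge> 0"
      unfolding maximal_def by (rule sum_nonneg) (simp add: sum_nonneg)
    ultimately show "0 \<le> (\<Prod>j<m. freq_weight p (2 ^ J) (a j)) * maximal a J v"
      by (rule mult_nonneg_nonneg)
  qed
  have "real (card (exceptional \<epsilon> J)) * (W * (ln (real p) / \<epsilon>)) = (\<Sum>v\<in>exceptional \<epsilon> J. W * (ln (real p) / \<epsilon>))"
    by simp
  also have "\<dots> \<le> (\<Sum>v\<in>exceptional \<epsilon> J. weighted_maximal J v)"
    by (intro sum_mono) (auto simp: exceptional_def W_def)
  also have "\<dots> \<le> (\<Sum>v\<in>V. weighted_maximal J v)"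
    using nn by (intro sum_mono2) (auto simp: exceptional_def)
  also have "\<dots> \<le> W * real p ^ (m + 1)"
    unfolding W_def using sum_weighted_maximal_le[OF J] .
  finally have "W * (real (card (exceptional \<epsilon> J)) * (ln (real p) / \<epsilon>)) \<le> W * real p ^ (m + 1)"
    by (simp only: mult_ac)
  then have "real (card (exceptional \<epsilon> J)) * (ln (real p) / \<epsilon>) \<le> real p ^ (m + 1)"
    using W by (simp only: mult_le_cancel_left_pos)
  then show ?thesis using lnp \<epsilon> by (simp add: field_simps)
qed

end

section \<open>From exceptional sets to the discrepancy bound\<close>

lemma ln_2_ge_half: "1 / 2 \<le> ln (2::real)"
  using ln_le_minus_one[of "1 / 2 :: real"] by (simp add: ln_div)

text \<open>With q = p^(1/(m+1)), both cases of \<open>B_bound\<close> have \<beta> = min(N,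
  q)^(-1/2) before the logarithms. Since m >= 1 gives q <= sqrt p, this \<beta> dominates N^(-1/2)
  and p^(-1/4), the two errors produced by the mean square estimate.\<close>

lemma B_bound_lower:
  assumes "m \<ge> 1" "N \<ge> 2" "p \<ge> 1"
  obtains \<beta> where "0 < \<beta>" "B_bound m N p = \<beta> * ln (real N) ^ (m + 1) * ln (real p)"
    "1 / real N \<le> \<beta>\<^sup>2" "1 / sqrt (real p) \<le> \<beta>\<^sup>2" "\<beta> \<le> 1"
proof -
  define q where "q = real p powr (1 / real (m + 1))"
  have p: "real p \<ge> 1" using assms by simp
  have q1: "q \<ge> 1" using ge_one_powr_ge_zero[OF p, of "1 / real (m + 1)"] by (simp add: q_def)
  have qs: "q \<le> sqrt (real p)"
  proof -
    have "1 / real (m + 1) \<le> 1 / 2" using assms by (simp add: field_simps)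
    then have "q \<le> real p powr (1 / 2)" unfolding q_def using p by (intro powr_mono) auto
    then show ?thesis using p by (simp add: powr_half_sqrt)
  qed
  have sq: "(x powr (- 1 / 2))\<^sup>2 = 1 / x" if "x > 0" for x :: real
    using that powr_add[of x "- 1 / 2" "- 1 / 2"] by (simp add: power2_eq_square powr_minus_divide)
  have le1: "x powr (- 1 / 2) \<le> 1" if "x \<ge> 1" for x :: real
    using that powr_mono[of "- 1 / 2" 0 x] by simp
  have Bq: "real p powr (- 1 / (2 * real (m + 1))) = q powr (- 1 / 2)"
    by (simp add: q_def powr_powr mult.commute)
  define \<beta> where "\<beta> = (if real N \<le> q then real N powr (- 1 / 2) else q powr (- 1 / 2))"
  show thesis
  proof (rule that[of \<beta>])
    show "0 < \<beta>" using assms q1 by (simp add: \<beta>_def)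
    show "B_bound m N p = \<beta> * ln (real N) ^ (m + 1) * ln (real p)"
      unfolding B_bound_def Bq q_def[symmetric] \<beta>_def by simp
    have \<beta>2: "\<beta>\<^sup>2 = (if real N \<le> q then 1 / real N else 1 / q)"
      using assms q1 sq[of "real N"] sq[of q] by (simp add: \<beta>_def)
    show "1 / real N \<le> \<beta>\<^sup>2" unfolding \<beta>2 using q1 by (auto intro!: divide_left_mono)
    show "1 / sqrt (real p) \<le> \<beta>\<^sup>2" unfolding \<beta>2 using q1 qs assms by (auto intro!: divide_left_mono)
    show "\<beta> \<le> 1" using assms q1 le1[of "real N"] le1[of q] by (simp add: \<beta>_def)
  qed
qed

context triangular_map
begin

lemma discrepancy_le_off_exceptional:
  assumes m: "m \<ge> 1" and \<epsilon>: "0 < \<epsilon>" "\<epsilon> < 1" and v: "v \<in> V" and N: "2 \<le> N"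
    and J: "2 ^ (J - 1) \<le> N" "N < 2 ^ J" and vE: "v \<notin> exceptional \<epsilon> J"
  shows "discrepancy m (\<lambda>n j. real_of_int ((F ^^ n) v j) / real p) N \<le>
    (real m * 2 ^ m * 2 ^ (m + 3) + 26 ^ m * 4 ^ (m + 2) * sqrt (real (1 + m + d))) *
    (inverse \<epsilon> * B_bound m N p)"
proof -
  obtain \<beta> where \<beta>: "0 < \<beta>" "B_bound m N p = \<beta> * ln (real N) ^ (m + 1) * ln (real p)"
    "1 / real N \<le> \<beta>\<^sup>2" "1 / sqrt (real p) \<le> \<beta>\<^sup>2" "\<beta> \<le> 1"
    using B_bound_lower[OF m N, of p] p_pos by auto
  define x where "x = ln (real N)"
  define y where "y = ln (real p)"
  define k where "k = sqrt (real (1 + m + d))"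
  have k0: "k \<ge> 0" by (simp add: k_def)
  have N0: "real N > 0" using N by simp
  have \<beta>2: "\<beta>\<^sup>2 \<le> \<beta>" using \<beta>(1,5) by (simp add: power2_eq_square mult_left_le)
  \<comment> \<open>N >= 2 keeps the logarithm away from zero; the lower bounds on x and y allow
    terms without logarithms to be absorbed.\<close>
  have x2: "1 / 2 \<le> x"
  proof -
    have "ln 2 \<le> ln (real N)" using N by simp
    then show ?thesis using ln_2_ge_half by (simp add: x_def)
  qed
  have y2: "1 / 2 \<le> y"
  proof -
    have "2 \<le> p" using p_gt_1 by simp
    then have "ln 2 \<le> ln (real p)" by simp
    then show ?thesis using ln_2_ge_half by (simp add: y_def)
  qed
  have J0: "J > 0" using N J(2) by (cases J) auto
  have "real (2 ^ (J - 1)) \<le> real N" using J(1) by (rule of_nat_mono)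
  then have NJ: "2 ^ J \<le> 2 * real N" using J0 by (cases J) auto
  \<comment> \<open>From (J - 1) ln 2 <= x and ln 2 >= 1/2 follows J <= 2 x + 1, and 1 <= 2
    x.\<close>
  have Jx: "real J \<le> 4 * x"
  proof -
    have "ln (real (2 ^ (J - 1))) \<le> x"
      unfolding x_def using J(1) N0 by (subst ln_le_cancel_iff) auto
    then have "real (J - 1) * ln 2 \<le> x" by (simp add: ln_realpow)
    moreover have "real (J - 1) * (1 / 2) \<le> real (J - 1) * ln 2"
      using ln_2_ge_half by (intro mult_left_mono) auto
    ultimately have "real (J - 1) \<le> 2 * x" by linarith
    moreover have "real J = real (J - 1) + 1" using J0 by simp
    ultimately show ?thesis using x2 by linarith
  qed
  \<comment> \<open>Inserting 2^J <= 2 N and the two lower bounds on \<beta>^2 gives 6 (\<beta>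
    N)^2, rounded up to 8 (\<beta> N)^2 so that 2 * 8 is a square.\<close>
  have spread: "spread J \<le> 4 * k * \<beta> * real N"
  proof -
    have "(2 ^ J)\<^sup>2 \<le> (2 * real N)\<^sup>2" using NJ by (intro power_mono) auto
    then have "2 ^ J + (2 ^ J)\<^sup>2 / sqrt (real p) \<le> 2 * real N + (2 * real N)\<^sup>2 / sqrt (real p)"
      using NJ by (intro add_mono divide_right_mono) auto
    also have "\<dots> = (real N)\<^sup>2 * (2 * (1 / real N) + 4 * (1 / sqrt (real p)))"
      using N0 by (simp add: power2_eq_square field_simps)
    also have "\<dots> \<le> (real N)\<^sup>2 * (2 * \<beta>\<^sup>2 + 4 * \<beta>\<^sup>2)"
      using \<beta>(3,4) by (intro mult_left_mono add_mono) auto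
    also have "\<dots> \<le> 8 * (\<beta> * real N)\<^sup>2" by (simp add: power_mult_distrib)
    finally have "2 * real (1 + m + d) * (2 ^ J + (2 ^ J)\<^sup>2 / sqrt (real p)) \<le>
        2 * real (1 + m + d) * (8 * (\<beta> * real N)\<^sup>2)"
      by (intro mult_left_mono) auto
    also have "\<dots> = (4 * k * \<beta> * real N)\<^sup>2"
      by (simp add: k_def power_mult_distrib)
    finally show ?thesis
      unfolding spread_def using k0 \<beta>(1) by (intro real_le_lsqrt) auto
  qed
  define Q where "Q = inverse \<epsilon> * (\<beta> * x ^ (m + 1) * y)"
  have disc: "discrepancy m (\<lambda>n j. real_of_int ((F ^^ n) v j) / real p) N \<le>
      real m * 2 ^ m * (1 / real (2 ^ J) + 1 / real p) +
      weighted_exp_sum p m (2 ^ J) (\<lambda>n j. (F ^^ n) v j) N / real N"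
  proof (rule discrepancy_le[OF p_pos])
    fix n j assume "j < m"
    then show "(F ^^ n) v j \<in> {0..<int p}" using iter_in[OF v] by (intro Fp_vecs_range) auto
  qed (use N in auto)
  have "weighted_exp_sum p m (2 ^ J) (\<lambda>n j. (F ^^ n) v j) N \<le>
      (26 * real J) ^ m * (real J * spread J) * (y / \<epsilon>)"
    using weighted_exp_sum_le_weighted_maximal[OF J(2), of v] vE v by (simp add: exceptional_def y_def)
  also have "\<dots> \<le> (26 * (4 * x)) ^ m * ((4 * x) * (4 * k * \<beta> * real N)) * (y / \<epsilon>)"
    using Jx spread spread_pos[of J] x2 y2 \<epsilon>
    by (intro mult_right_mono mult_mono power_mono) (auto intro!: mult_nonneg_nonneg)
  also have "\<dots> = 26 ^ m * 4 ^ (m + 2) * k * Q * real N"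
  proof -
    have "(26 * (4 * x)) ^ m = 26 ^ m * 4 ^ m * x ^ m" by (simp only: power_mult_distrib mult.assoc)
    then show ?thesis by (simp add: Q_def power_add field_simps)
  qed
  finally have err: "weighted_exp_sum p m (2 ^ J) (\<lambda>n j. (F ^^ n) v j) N / real N \<le> 26 ^ m * 4 ^ (m + 2) * k * Q"
    using N0 by (simp add: pos_divide_le_eq)
  have "1 / real (2 ^ J) + 1 / real p \<le> 2 * \<beta>"
  proof -
    have "real N \<le> real (2 ^ J)" using J(2) by (intro of_nat_mono) simp
    then have "1 / real (2 ^ J) \<le> 1 / real N"
      using N0 by (intro divide_left_mono) auto
    moreover have "1 / real p \<le> 1 / sqrt (real p)"
    proof (intro divide_left_mono)
      have "sqrt (real p) \<le> sqrt (real p * real p)"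
        using p_pos by (intro real_sqrt_le_mono) simp
      then show "sqrt (real p) \<le> real p" by simp
    qed (use p_pos in auto)
    ultimately show ?thesis using \<beta>(3,4) \<beta>2 by linarith
  qed
  \<comment> \<open>The factors (2 x)^(m + 1), 2 y and 1/\<epsilon> are all at least 1 and may be
    multiplied in; the powers of two add up to 1 + (m + 1) + 1.\<close>
  also have "\<dots> \<le> 2 ^ (m + 3) * Q"
  proof -
    have "1 \<le> (2 * x) ^ (m + 1)" using x2 by (intro one_le_power) simp
    moreover have "1 \<le> (2 * y) * inverse \<epsilon>"
      using y2 \<epsilon> mult_mono[of 1 "2 * y" 1 "inverse \<epsilon>"] by (simp add: one_le_inverse)
    ultimately have "1 * 1 \<le> (2 * x) ^ (m + 1) * ((2 * y) * inverse \<epsilon>)"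
      by (intro mult_mono) (use x2 in auto)
    then have "2 * \<beta> * (1 * 1) \<le> 2 * \<beta> * ((2 * x) ^ (m + 1) * ((2 * y) * inverse \<epsilon>))"
      using \<beta>(1) by (intro mult_left_mono) auto
    also have "\<dots> = 2 ^ (m + 3) * Q"
      by (simp add: Q_def power_mult_distrib power_add power3_eq_cube mult_ac)
    finally show ?thesis by simp
  qed
  finally have "real m * 2 ^ m * (1 / real (2 ^ J) + 1 / real p) \<le> real m * 2 ^ m * (2 ^ (m + 3) * Q)"
    by (intro mult_left_mono) auto
  then have "discrepancy m (\<lambda>n j. real_of_int ((F ^^ n) v j) / real p) N \<le>
      real m * 2 ^ m * (2 ^ (m + 3) * Q) + 26 ^ m * 4 ^ (m + 2) * k * Q"
    using disc err by linarith
  then show ?thesis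
    by (simp only: \<beta>(2) Q_def x_def y_def k_def distrib_right mult.assoc)
qed

lemma exceptional_set_exists:
  assumes m: "m \<ge> 1" and \<epsilon>: "0 < \<epsilon>" "\<epsilon> < 1"
  shows "\<exists>E\<subseteq>V. real (card E) \<le> (real (m + 2) / ln 2) * (\<epsilon> * real p ^ (m + 1)) \<and>
    (\<forall>v\<in>V - E. \<forall>N. 2 \<le> N \<and> N \<le> p ^ (m + 1) \<longrightarrow>
      discrepancy m (\<lambda>n j. real_of_int ((F ^^ n) v j) / real p) N \<le>
      (real m * 2 ^ m * 2 ^ (m + 3) + 26 ^ m * 4 ^ (m + 2) * sqrt (real (1 + m + d))) *
      (inverse \<epsilon> * B_bound m N p))"
proof -
  \<comment> \<open>The scales J whose range from 2^(J-1) to 2^J - 1 contains some N <= p^(m+1).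
    There are O(ln p) of them, and the union of their exceptional sets serves every N at
    once.\<close>
  define I where "I = {J. 0 < J \<and> 2 ^ (J - 1) \<le> p ^ (m + 1)}"
  define y where "y = ln (real p)"
  have ln2: "ln (2::real) > 0" by simp
  have y: "ln 2 \<le> y" "y > 0" using p_gt_1 by (auto simp: y_def)
  have I_le: "real J \<le> real (m + 2) * y / ln 2" if "J \<in> I" for J
  proof -
    have "real (2 ^ (J - 1)) \<le> real (p ^ (m + 1))" using that unfolding I_def by (intro of_nat_mono) auto
    then have "ln (real (2 ^ (J - 1))) \<le> ln (real (p ^ (m + 1)))"
      using p_pos by (subst ln_le_cancel_iff) auto
    then have "real (J - 1) * ln 2 \<le> real (m + 1) * y"
      using p_pos by (simp add: ln_realpow y_def del: power_Suc of_nat_Suc)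
    moreover have "real J * ln 2 = real (J - 1) * ln 2 + ln 2"
      using that by (cases J) (simp_all add: I_def distrib_right)
    moreover have "real (m + 2) * y = real (m + 1) * y + y" by (simp add: distrib_right)
    ultimately have "real J * ln 2 \<le> real (m + 2) * y"
      using y(1) by linarith
    then show ?thesis using ln2 by (simp add: pos_le_divide_eq)
  qed
  then have sub: "I \<subseteq> {1..nat \<lfloor>real (m + 2) * y / ln 2\<rfloor>}"
    by (auto simp: I_def le_nat_floor)
  then have "card I \<le> nat \<lfloor>real (m + 2) * y / ln 2\<rfloor>"
    using card_mono[OF _ sub] by simp
  moreover have "real (nat \<lfloor>real (m + 2) * y / ln 2\<rfloor>) \<le> real (m + 2) * y / ln 2"
    using less_imp_le[OF y(2)] ln2 by (intro of_nat_floor divide_nonneg_pos mult_nonneg_nonneg) auto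
  ultimately have cardI: "real (card I) \<le> real (m + 2) * y / ln 2" by linarith
  have finI: "finite I" using sub by (rule finite_subset) simp
  define E where "E = (\<Union>J\<in>I. exceptional \<epsilon> J)"
  have "real (card E) \<le> real (\<Sum>J\<in>I. card (exceptional \<epsilon> J))"
    unfolding E_def by (intro of_nat_mono card_UN_le finI)
  also have "\<dots> \<le> (\<Sum>J\<in>I. \<epsilon> * real p ^ (m + 1) / y)"
    unfolding of_nat_sum y_def using \<epsilon> by (intro sum_mono card_exceptional_le) (auto simp: I_def)
  also have "\<dots> = real (card I) * (\<epsilon> * real p ^ (m + 1) / y)" by simp
  also have "\<dots> \<le> (real (m + 2) * y / ln 2) * (\<epsilon> * real p ^ (m + 1) / y)"
    using \<epsilon> y by (intro mult_right_mono cardI) auto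
  also have "\<dots> = (real (m + 2) / ln 2) * (\<epsilon> * real p ^ (m + 1))"
    using y by simp
  finally have cardE: "real (card E) \<le> (real (m + 2) / ln 2) * (\<epsilon> * real p ^ (m + 1))" .
  show ?thesis
  proof (intro exI[of _ E] conjI cardE ballI allI impI)
    show "E \<subseteq> V" by (auto simp: E_def exceptional_def)
  next
    fix v N assume v: "v \<in> V - E" and N: "2 \<le> N \<and> N \<le> p ^ (m + 1)"
    obtain k where k: "2 ^ k \<le> N" "N < 2 ^ (k + 1)"
      using ex_power_ivl1[of 2 N] N by auto
    have "Suc k \<in> I" using k(1) N by (auto simp: I_def)
    then have "v \<notin> exceptional \<epsilon> (Suc k)" using v by (auto simp: E_def)
    then show "discrepancy m (\<lambda>n j. real_of_int ((F ^^ n) v j) / real p) N \<le>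
        (real m * 2 ^ m * 2 ^ (m + 3) + 26 ^ m * 4 ^ (m + 2) * sqrt (real (1 + m + d))) *
        (inverse \<epsilon> * B_bound m N p)"
      using v N k m \<epsilon> by (intro discrepancy_le_off_exceptional[where J = "Suc k"]) auto
  qed
qed

end

section \<open>Triangular polynomial systems\<close>

definition monom_val :: "(nat \<Rightarrow>\<^sub>0 nat) \<Rightarrow> (nat \<Rightarrow> int) \<Rightarrow> int" where
  "monom_val t x = (\<Prod>j\<in>Poly_Mapping.keys t. x j ^ Poly_Mapping.lookup t j)"

lemma monom_val_superset:
  assumes "finite V" "Poly_Mapping.keys t \<subseteq> V"
  shows "monom_val t x = (\<Prod>j\<in>V. x j ^ Poly_Mapping.lookup t j)"
  unfolding monom_val_def using assms by (intro prod.mono_neutral_left) (auto simp: in_keys_iff)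

lemma monom_val_add: "monom_val (s + t) x = monom_val s x * monom_val t x"
proof -
  let ?V = "Poly_Mapping.keys s \<union> Poly_Mapping.keys t"
  have "monom_val (s + t) x = (\<Prod>j\<in>?V. x j ^ Poly_Mapping.lookup (s + t) j)"
    using keys_add[of s t] by (intro monom_val_superset) auto
  also have "\<dots> = (\<Prod>j\<in>?V. x j ^ Poly_Mapping.lookup s j) * (\<Prod>j\<in>?V. x j ^ Poly_Mapping.lookup t j)"
    by (simp add: lookup_add power_add prod.distrib)
  also have "\<dots> = monom_val s x * monom_val t x"
    by (simp add: monom_val_superset[of ?V])
  finally show ?thesis .
qed

lemma mp_eval_alt: "mp_eval P x = (\<Sum>t\<in>Poly_Mapping.keys P. Poly_Mapping.lookup P t * monom_val t x)"
  by (simp add: mp_eval_def monom_val_def)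

lemma mp_eval_alt_superset:
  assumes "finite A" "Poly_Mapping.keys P \<subseteq> A"
  shows "mp_eval P x = (\<Sum>t\<in>A. Poly_Mapping.lookup P t * monom_val t x)"
  unfolding mp_eval_alt using assms by (intro sum.mono_neutral_left) (auto simp: in_keys_iff)

lemma mp_eval_add: "mp_eval (P + Q) x = mp_eval P x + mp_eval Q x"
proof -
  let ?A = "Poly_Mapping.keys P \<union> Poly_Mapping.keys Q"
  have "mp_eval (P + Q) x = (\<Sum>t\<in>?A. Poly_Mapping.lookup (P + Q) t * monom_val t x)"
    using keys_add[of P Q] by (intro mp_eval_alt_superset) auto
  then show ?thesis
    by (simp add: lookup_add distrib_right sum.distrib mp_eval_alt_superset[of ?A])
qed

lemma mp_eval_single: "mp_eval (Poly_Mapping.single t a) x = a * monom_val t x"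
  by (simp add: mp_eval_alt lookup_single)

lemma mp_eval_0 [simp]: "mp_eval 0 x = 0"
  by (simp add: mp_eval_def)

lemma mp_eval_1 [simp]: "mp_eval 1 x = 1"
  by (simp add: mp_eval_def lookup_one)

lemma mp_eval_sum: "mp_eval (\<Sum>i\<in>I. P i) x = (\<Sum>i\<in>I. mp_eval (P i) x)"
  by (induction I rule: infinite_finite_induct) (simp_all add: mp_eval_add)

lemma poly_mapping_eq_sum_single:
  "P = (\<Sum>t\<in>Poly_Mapping.keys P. Poly_Mapping.single t (Poly_Mapping.lookup P t))"
  by (rule poly_mapping_eqI)
    (auto simp: lookup_sum lookup_single when_def in_keys_iff sum.delta)

lemma mp_eval_mult: "mp_eval (P * Q) x = mp_eval P x * mp_eval Q x"
proof -
  have "P * Q = (\<Sum>s\<in>Poly_Mapping.keys P. \<Sum>t\<in>Poly_Mapping.keys Q.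
      Poly_Mapping.single (s + t) (Poly_Mapping.lookup P s * Poly_Mapping.lookup Q t))"
    by (subst poly_mapping_eq_sum_single[of P], subst poly_mapping_eq_sum_single[of Q])
      (simp add: sum_product mult_single)
  then have "mp_eval (P * Q) x = (\<Sum>s\<in>Poly_Mapping.keys P. \<Sum>t\<in>Poly_Mapping.keys Q.
      (Poly_Mapping.lookup P s * monom_val s x) * (Poly_Mapping.lookup Q t * monom_val t x))"
    by (simp add: mp_eval_sum mp_eval_single monom_val_add mult_ac)
  then show ?thesis
    by (simp add: mp_eval_alt sum_product)
qed

lemma mp_eval_Var [simp]: "mp_eval (Var j) x = x j"
  by (simp add: Var_def mp_eval_single monom_val_def)

lemma mp_eval_Const [simp]: "mp_eval (Const a) x = a"
  by (simp add: Const_def mp_eval_single monom_val_def)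

lemma mp_eval_power: "mp_eval (P ^ n) x = mp_eval P x ^ n"
  by (induction n) (simp_all add: mp_eval_mult)

lemma mp_eval_prod: "mp_eval (\<Prod>i\<in>I. P i) x = (\<Prod>i\<in>I. mp_eval (P i) x)"
  by (induction I rule: infinite_finite_induct) (simp_all add: mp_eval_mult)

text \<open>Congruence modulo the ideal generated by p is the form in which compatibility with ring
  operations and evaluation is immediate. The witness is the coefficientwise quotient of P - Q by p,
  exact by the congruences.\<close>

lemma Fp_eq_iff: "Fp_eq p P Q \<longleftrightarrow> (\<exists>R. P = Q + Const (int p) * R)"
proof
  assume eq: "Fp_eq p P Q"
  define R where "R = Poly_Mapping.map (\<lambda>c. c div int p) (P - Q)"
  have R: "int p * Poly_Mapping.lookup R t = Poly_Mapping.lookup (P - Q) t" for t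
    using eq by (auto simp: R_def map.rep_eq when_def lookup_minus Fp_eq_def cong_iff_dvd_diff)
  have "P - Q = Const (int p) * R"
  proof (rule poly_mapping_eqI)
    fix t
    have "Const (int p) * R = Poly_Mapping.map ((*) (int p)) R"
      by (simp add: Const_def mult_map_scale_conv_mult)
    then show "Poly_Mapping.lookup (P - Q) t = Poly_Mapping.lookup (Const (int p) * R) t"
      using R[of t, symmetric] by (simp add: map.rep_eq when_def)
  qed
  then show "\<exists>R. P = Q + Const (int p) * R" by (intro exI[of _ R]) (simp add: algebra_simps)
next
  assume "\<exists>R. P = Q + Const (int p) * R"
  then obtain R where P: "P = Q + Const (int p) * R" by blast
  have "Const (int p) * R = Poly_Mapping.map ((*) (int p)) R"
    by (simp add: Const_def mult_map_scale_conv_mult)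
  then show "Fp_eq p P Q"
    by (auto simp: P Fp_eq_def lookup_add map.rep_eq when_def cong_iff_dvd_diff)
qed

lemma Fp_eq_trans: "Fp_eq p P Q \<Longrightarrow> Fp_eq p Q R \<Longrightarrow> Fp_eq p P R"
  by (auto simp: Fp_eq_def intro: cong_trans)

lemma Fp_eq_add_mult:
  assumes "Fp_eq p P Q"
  shows "Fp_eq p (X * P + Y) (X * Q + Y)"
proof -
  from assms obtain R where "P = Q + Const (int p) * R" by (auto simp: Fp_eq_iff)
  then have "X * P + Y = (X * Q + Y) + Const (int p) * (X * R)" by (simp add: algebra_simps)
  then show ?thesis unfolding Fp_eq_iff by blast
qed

lemma mp_eval_cong_Fp_eq:
  assumes "Fp_eq p P Q"
  shows "[mp_eval P x = mp_eval Q x] (mod int p)"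
proof -
  from assms obtain R where "P = Q + Const (int p) * R" by (auto simp: Fp_eq_iff)
  then show ?thesis by (simp add: mp_eval_add mp_eval_mult cong_iff_dvd_diff)
qed

lemma mp_eval_cong_vars:
  assumes "P \<in> Fp_polys p V" "\<And>j. j \<in> V \<Longrightarrow> x j = y j"
  shows "mp_eval P x = mp_eval P y"
  unfolding mp_eval_def
proof (intro sum.cong refl arg_cong2[of _ _ _ _ "(*)"] prod.cong)
  fix t j assume "t \<in> Poly_Mapping.keys P" "j \<in> Poly_Mapping.keys t"
  then have "x j = y j" using assms unfolding Fp_polys_def by blast
  then show "x j ^ Poly_Mapping.lookup t j = y j ^ Poly_Mapping.lookup t j" by simp
qed

section \<open>Degrees and restriction to one variable\<close>

lemma deg_in_ge: "t \<in> Poly_Mapping.keys P \<Longrightarrow> int (Poly_Mapping.lookup t j) \<le> deg_in j P"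
  unfolding deg_in_def by (intro Max_ge) auto

lemma total_deg_ge:
  assumes "t \<in> Poly_Mapping.keys P"
  shows "int (Poly_Mapping.lookup t j) \<le> total_deg P"
proof -
  have "Poly_Mapping.lookup t j \<le> (\<Sum>j\<in>Poly_Mapping.keys t. Poly_Mapping.lookup t j)"
  proof (cases "j \<in> Poly_Mapping.keys t")
    case False
    then show ?thesis by (simp add: in_keys_iff)
  qed (auto intro: member_le_sum)
  also have "int \<dots> \<le> total_deg P"
    unfolding total_deg_def using assms by (intro Max_ge) auto
  finally show ?thesis by simp
qed

text \<open>P viewed as a polynomial in X_j alone, the variables indexed by V being specialised to
  the values x.\<close>

definition slice :: "nat \<Rightarrow> nat set \<Rightarrow> mpoly \<Rightarrow> (nat \<Rightarrow> int) \<Rightarrow> int poly" where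
  "slice j V P x = (\<Sum>t\<in>Poly_Mapping.keys P.
     monom (Poly_Mapping.lookup P t * (\<Prod>l\<in>V. x l ^ Poly_Mapping.lookup t l)) (Poly_Mapping.lookup t j))"

lemma poly_slice:
  assumes "finite V" "j \<notin> V" "\<And>t. t \<in> Poly_Mapping.keys P \<Longrightarrow> Poly_Mapping.keys t \<subseteq> insert j V"
  shows "poly (slice j V P x) (x j) = mp_eval P x"
proof -
  have "poly (slice j V P x) (x j) = (\<Sum>t\<in>Poly_Mapping.keys P.
      Poly_Mapping.lookup P t * (\<Prod>l\<in>insert j V. x l ^ Poly_Mapping.lookup t l))"
    using assms(1,2) by (simp add: slice_def poly_sum poly_monom mult_ac)
  also have "\<dots> = mp_eval P x"
    unfolding mp_eval_alt using assms
    by (intro sum.cong refl) (simp add: monom_val_superset[of "insert j V"] del: prod.insert)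
  finally show ?thesis .
qed

lemma slice_cong: "(\<And>l. l \<in> V \<Longrightarrow> x l = y l) \<Longrightarrow> slice j V P x = slice j V P y"
  unfolding slice_def by (intro sum.cong refl arg_cong2[of _ _ _ _ monom] arg_cong2[of _ _ _ _ "(*)"] prod.cong) auto

lemma degree_slice_less:
  assumes "deg_in j P < int s" "s > 0"
  shows "degree (slice j V P x) < s"
proof -
  have "degree (slice j V P x) \<le> s - 1"
    unfolding slice_def
  proof (intro degree_sum_le)
    fix t assume "t \<in> Poly_Mapping.keys P"
    then have "Poly_Mapping.lookup t j \<le> s - 1" using deg_in_ge[of t P j] assms by linarith
    with degree_monom_le show "degree (monom (Poly_Mapping.lookup P t * (\<Prod>l\<in>V. x l ^ Poly_Mapping.lookup t l))
        (Poly_Mapping.lookup t j)) \<le> s - 1"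
      by (rule order_trans)
  qed simp
  then show ?thesis using assms by linarith
qed

text \<open>This serves to bound the exponents s_{i,i+1} by d, uniformly in p. The product of X_i
  and the leading monomial of G has coefficient 1 modulo p in P: it cannot cancel against X_i G',
  where the exponent of X_j is too small, nor against H, where X_i does not occur.\<close>

lemma leading_exponent_le_total_deg:
  assumes p: "p > 1" and P: "Fp_eq p P (Var i * G + H)"
    and G: "Fp_eq p G ((\<Prod>l\<in>I. Var l ^ s l) + G')"
    and I: "finite I" "j \<in> I" "i \<notin> I"
    and G'deg: "deg_in j G' < int (s j)"
    and H: "\<And>t. t \<in> Poly_Mapping.keys H \<Longrightarrow> Poly_Mapping.keys t \<subseteq> I"
  shows "int (s j) \<le> total_deg P"
proof -
  define \<mu> :: "nat \<Rightarrow>\<^sub>0 nat" where "\<mu> = (\<Sum>l\<in>I. Poly_Mapping.single l (s l))"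
  have Vpow: "Var l ^ n = Poly_Mapping.single (Poly_Mapping.single l n) 1" for l n
    by (induction n) (simp_all add: Var_def mult_single single_add[symmetric])
  have prodV: "(\<Prod>l\<in>I. Var l ^ s l) = Poly_Mapping.single \<mu> (1 :: int)"
    unfolding \<mu>_def Vpow using I(1) by (induction I rule: finite_induct) (simp_all add: mult_single)
  define \<nu> where "\<nu> = Poly_Mapping.single i 1 + \<mu>"
  have look\<mu>: "Poly_Mapping.lookup \<mu> l = (if l \<in> I then s l else 0)" for l
    using I(1) by (simp add: \<mu>_def lookup_sum lookup_single when_def sum.delta')
  have \<nu>: "Poly_Mapping.lookup \<nu> j = s j" "Poly_Mapping.lookup \<nu> i = 1"
    using I by (auto simp: \<nu>_def lookup_add look\<mu> lookup_single when_def)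
  have "Fp_eq p P (Var i * ((\<Prod>l\<in>I. Var l ^ s l) + G') + H)"
    using P Fp_eq_add_mult[OF G] by (rule Fp_eq_trans)
  also have "Var i * ((\<Prod>l\<in>I. Var l ^ s l) + G') + H =
      Poly_Mapping.single \<nu> 1 + Var i * G' + H"
    unfolding prodV distrib_left unfolding Var_def mult_single \<nu>_def by simp
  finally have "[Poly_Mapping.lookup P \<nu> = Poly_Mapping.lookup (Poly_Mapping.single \<nu> 1 + Var i * G' + H) \<nu>] (mod int p)"
    by (simp add: Fp_eq_def)
  moreover have "\<nu> \<notin> Poly_Mapping.keys (Var i * G')"
  proof
    assume "\<nu> \<in> Poly_Mapping.keys (Var i * G')"
    then obtain t where t: "t \<in> Poly_Mapping.keys G'" "\<nu> = Poly_Mapping.single i 1 + t"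
      using keys_mult[of "Var i" G'] by (auto simp: Var_def)
    then have "\<mu> = t" by (simp add: \<nu>_def)
    then have "Poly_Mapping.lookup t j = s j" using look\<mu>[of j] I(2) by simp
    then show False using deg_in_ge[OF t(1), of j] G'deg by simp
  qed
  moreover have "\<nu> \<notin> Poly_Mapping.keys H"
  proof
    assume "\<nu> \<in> Poly_Mapping.keys H"
    from H[OF this] have "i \<notin> Poly_Mapping.keys \<nu>" using I by auto
    then show False using \<nu>(2) by (simp add: in_keys_iff)
  qed
  ultimately have "[Poly_Mapping.lookup P \<nu> = 1] (mod int p)"
    by (simp add: lookup_add in_keys_iff)
  then have "Poly_Mapping.lookup P \<nu> \<noteq> 0"
    using p by (auto simp: Cong.cong_def)
  then have "int (Poly_Mapping.lookup \<nu> j) \<le> total_deg P"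
    by (intro total_deg_ge) (simp add: in_keys_iff)
  then show ?thesis by (simp add: \<nu>)
qed

lemma triangular_map_of_system:
  assumes p: "prime p"
    and tri: "triangular_system p m f" and deg: "system_deg m f = int d" and perm: "permutation_system p m f"
  shows "\<exists>g h c. triangular_map p m d (system_map p m f) g h c"
proof -
  have p1: "p > 1" using p prime_gt_1_nat by blast
  from tri obtain a b s where
    ab: "Fp_eq p (f m) (Const a * Var m + Const b)"
    and s0: "(\<Prod>i<m. s i (i + 1)) \<noteq> (0::nat)"
    and ex: "\<forall>i<m. \<exists>g \<in> Fp_polys p {i<..m}. \<exists>h \<in> Fp_polys p {i<..m}. \<exists>g' \<in> Fp_polys p {i<..m}.
           Fp_eq p (f i) (Var i * g + h) \<and>
           Fp_eq p g ((\<Prod>j\<in>{i<..m}. Var j ^ s i j) + g') \<and>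
           (\<forall>j\<in>{i<..m}. deg_in j g' < int (s i j) \<and> deg_in j h \<le> int (s i j))"
    unfolding triangular_system_def by blast
  define good where "good i g h g' \<longleftrightarrow> g \<in> Fp_polys p {i<..m} \<and> h \<in> Fp_polys p {i<..m} \<and> g' \<in> Fp_polys p {i<..m} \<and>
           Fp_eq p (f i) (Var i * g + h) \<and>
           Fp_eq p g ((\<Prod>j\<in>{i<..m}. Var j ^ s i j) + g') \<and>
           (\<forall>j\<in>{i<..m}. deg_in j g' < int (s i j))" for i g h g'
  have "\<forall>i. \<exists>g h g'. i < m \<longrightarrow> good i g h g'"
    using ex unfolding good_def by blast
  then obtain gp hp gp' where good: "\<And>i. i < m \<Longrightarrow> good i (gp i) (hp i) (gp' i)"
    by metis
  have keys: "Poly_Mapping.keys t \<subseteq> V" if "P \<in> Fp_polys p V" "t \<in> Poly_Mapping.keys P" for P V t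
    using that by (auto simp: Fp_polys_def)
  \<comment> \<open>At the last index the constants a and b put f_m into the same affine shape as
    the other components.\<close>
  define g where "g i x = (if i < m then mp_eval (gp i) x else a)" for i x
  define h where "h i x = (if i < m then mp_eval (hp i) x else b)" for i x
  \<comment> \<open>The leading monomial of g_i with the later coordinates substituted, plus the
    slice of its remainder, which has smaller degree in X_(i+1).\<close>
  define c where "c i x = monom (\<Prod>l\<in>{Suc i<..m}. x l ^ s i l) (s i (Suc i)) +
      slice (Suc i) {Suc i<..m} (gp' i) x" for i x
  have spos: "s i (Suc i) > 0" if "i < m" for i
  proof -
    have "s i (Suc i) \<noteq> 0" using s0 that by simp
    then show ?thesis by simp
  qed
  have ivl: "{i<..m} = insert (Suc i) {Suc i<..m}" if "i < m" for i
    using that by auto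
  have "triangular_map p m d (system_map p m f) g h c"
  proof (unfold_locales)
    show "prime p" by (rule p)
    show "bij_betw (system_map p m f) (Fp_vecs p m) (Fp_vecs p m)"
      using perm by (simp add: permutation_system_def)
  next
    fix w j assume "w \<in> Fp_vecs p m" and j: "j \<le> m"
    have "[mp_eval (f j) w = w j * g j w + h j w] (mod int p)"
    proof (cases "j < m")
      case True
      then have "Fp_eq p (f j) (Var j * gp j + hp j)" using good[OF True] by (simp add: good_def)
      from mp_eval_cong_Fp_eq[OF this, of w] show ?thesis
        using True by (simp add: mp_eval_add mp_eval_mult g_def h_def)
    next
      case False
      then have "j = m" using j by simp
      then show ?thesis
        using mp_eval_cong_Fp_eq[OF ab, of w] by (simp add: mp_eval_add mp_eval_mult g_def h_def mult.commute)
    qed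
    then show "system_map p m f w j = (w j * g j w + h j w) mod int p"
      using j by (simp add: system_map_def Cong.cong_def)
  next
    fix j and w w' :: "nat \<Rightarrow> int"
    assume "j \<le> m" and eq: "\<And>i. i \<in> {j<..m} \<Longrightarrow> w i = w' i"
    have "mp_eval (gp j) w = mp_eval (gp j) w'" if "j < m"
      using good[OF that] eq by (intro mp_eval_cong_vars[where V = "{j<..m}"]) (auto simp: good_def)
    then show "g j w = g j w'" by (simp add: g_def)
    have "mp_eval (hp j) w = mp_eval (hp j) w'" if "j < m"
      using good[OF that] eq by (intro mp_eval_cong_vars[where V = "{j<..m}"]) (auto simp: good_def)
    then show "h j w = h j w'" by (simp add: h_def)
  next
    fix i w assume i: "i < m"
    have "Fp_eq p (gp i) ((\<Prod>j\<in>{i<..m}. Var j ^ s i j) + gp' i)" using good[OF i] by (simp add: good_def)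
    from mp_eval_cong_Fp_eq[OF this, of w]
    have "[mp_eval (gp i) w = (\<Prod>j\<in>{i<..m}. w j ^ s i j) + mp_eval (gp' i) w] (mod int p)"
      by (simp add: mp_eval_add mp_eval_prod mp_eval_power)
    moreover have "poly (slice (Suc i) {Suc i<..m} (gp' i) w) (w (Suc i)) = mp_eval (gp' i) w"
    proof (rule poly_slice)
      fix t assume "t \<in> Poly_Mapping.keys (gp' i)"
      then show "Poly_Mapping.keys t \<subseteq> insert (Suc i) {Suc i<..m}"
        using keys[of "gp' i" "{i<..m}" t] good[OF i] by (simp add: good_def ivl[OF i])
    qed auto
    ultimately show "[g i w = poly (c i w) (w (Suc i))] (mod int p)"
      using i by (simp add: g_def c_def poly_monom ivl[OF i] mult.commute)
  next
    fix i and w w' :: "nat \<Rightarrow> int"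
    assume "i < m" and eq: "\<And>j. j \<in> {Suc i<..m} \<Longrightarrow> w j = w' j"
    have "slice (Suc i) {Suc i<..m} (gp' i) w = slice (Suc i) {Suc i<..m} (gp' i) w'"
      using eq by (rule slice_cong)
    moreover have "(\<Prod>l\<in>{Suc i<..m}. w l ^ s i l) = (\<Prod>l\<in>{Suc i<..m}. w' l ^ s i l)"
      using eq by (intro prod.cong) auto
    ultimately show "c i w = c i w'" by (simp only: c_def)
  next
    fix i w assume i: "i < m" and w: "w \<in> Fp_vecs p m" and nz: "\<And>j. j \<in> {Suc i<..m} \<Longrightarrow> w j \<noteq> 0"
    define L where "L = (\<Prod>l\<in>{Suc i<..m}. w l ^ s i l)"
    have pint: "Factorial_Ring.prime (int p)" using p by simp
    have "\<not> int p dvd w l" if "l \<in> {Suc i<..m}" for l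
      using nz[OF that] Fp_vecs_range[OF w, of l] that zdvd_not_zless[of "w l" "int p"] by auto
    then have "\<not> int p dvd w l ^ s i l" if "l \<in> {Suc i<..m}" for l
      using that prime_dvd_power[OF pint, of "w l" "s i l"] by blast
    then have L: "\<not> int p dvd L"
      unfolding L_def using pint by (auto simp: prime_dvd_prod_iff)
    then have L0: "L \<noteq> 0" by auto
    define S where "S = slice (Suc i) {Suc i<..m} (gp' i) w"
    have "Suc i \<in> {i<..m}" using i by simp
    then have "deg_in (Suc i) (gp' i) < int (s i (Suc i))" using good[OF i] by (simp add: good_def)
    then have S: "degree S < s i (Suc i)" unfolding S_def using spos[OF i] by (rule degree_slice_less)
    have c: "c i w = monom L (s i (Suc i)) + S" by (simp add: c_def L_def S_def)
    have degM: "degree (monom L (s i (Suc i))) = s i (Suc i)" using L0 by (rule degree_monom_eq)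
    have degc: "degree (c i w) = s i (Suc i)" unfolding c using S degM by (simp add: degree_add_eq_left)
    have lead: "lead_coeff (c i w) = L"
      unfolding degc unfolding c using S by (simp add: coeff_eq_0)
    have f_eq: "Fp_eq p (f i) (Var i * gp i + hp i)"
      and g_eq: "Fp_eq p (gp i) ((\<Prod>l\<in>{i<..m}. Var l ^ s i l) + gp' i)"
      using good[OF i] by (auto simp: good_def)
    have "int (s i (Suc i)) \<le> total_deg (f i)"
    proof (rule leading_exponent_le_total_deg[OF p1 f_eq g_eq])
      show "Poly_Mapping.keys t \<subseteq> {i<..m}" if "t \<in> Poly_Mapping.keys (hp i)" for t
        using keys[OF _ that] good[OF i] by (simp add: good_def)
      show "deg_in (Suc i) (gp' i) < int (s i (Suc i))" by fact
    qed (use i in auto)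
    moreover have "total_deg (f i) \<le> int d"
      unfolding deg[symmetric] system_deg_def using i by (intro Max_ge) auto
    ultimately show "degree (c i w) \<in> {1..d} \<and> \<not> int p dvd lead_coeff (c i w)"
      using L spos[OF i] degc lead by auto
  qed
  then show ?thesis by blast
qed

lemma gen_seq_eq_funpow: "gen_seq p m f v n = (system_map p m f ^^ n) v"
  by (induction n) simp_all

theorem theorem5:
  fixes m d :: nat
  assumes "1 \<le> m" and "2 \<le> d"
  shows "\<exists>c C :: real. 0 < c \<and> 0 < C \<and>
    (\<forall>(p :: nat) (\<epsilon> :: real) (f :: nat \<Rightarrow> mpoly).
       prime p \<and> 0 < \<epsilon> \<and> \<epsilon> < 1 \<and>
       triangular_system p m f \<and> system_deg m f = int d \<and> permutation_system p m f \<longrightarrow>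
       (\<exists>E \<subseteq> Fp_vecs p m.
          real (card E) \<le> c * (\<epsilon> * real p ^ (m + 1)) \<and>
          (\<forall>v \<in> Fp_vecs p m - E. \<forall>N :: nat. 2 \<le> N \<and> N \<le> p ^ (m + 1) \<longrightarrow>
             gen_discrepancy p m f v N \<le> C * (inverse \<epsilon> * B_bound m N p))))"
\<comment> \<open>Both constants are fixed before p, \<epsilon> and f, and depend on m and d
  only.\<close>
proof (rule exI[of _ "real (m + 2) / ln 2"],
    rule exI[of _ "real m * 2 ^ m * 2 ^ (m + 3) + 26 ^ m * 4 ^ (m + 2) * sqrt (real (1 + m + d))"],
    intro conjI allI impI)
  show "0 < real (m + 2) / ln 2" by simp
  show "0 < real m * 2 ^ m * 2 ^ (m + 3) + 26 ^ m * 4 ^ (m + 2) * sqrt (real (1 + m + d))"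
    by (intro add_nonneg_pos mult_pos_pos) auto
next
  fix p :: nat and \<epsilon> :: real and f :: "nat \<Rightarrow> mpoly"
  assume H: "prime p \<and> 0 < \<epsilon> \<and> \<epsilon> < 1 \<and>
       triangular_system p m f \<and> system_deg m f = int d \<and> permutation_system p m f"
  then obtain g h c where "triangular_map p m d (system_map p m f) g h c"
    using triangular_map_of_system by blast
  then interpret triangular_map p m d "system_map p m f" g h c .
  show "\<exists>E \<subseteq> Fp_vecs p m.
          real (card E) \<le> (real (m + 2) / ln 2) * (\<epsilon> * real p ^ (m + 1)) \<and>
          (\<forall>v \<in> Fp_vecs p m - E. \<forall>N :: nat. 2 \<le> N \<and> N \<le> p ^ (m + 1) \<longrightarrow>
             gen_discrepancy p m f v N \<le>
             (real m * 2 ^ m * 2 ^ (m + 3) + 26 ^ m * 4 ^ (m + 2) * sqrt (real (1 + m + d))) *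
             (inverse \<epsilon> * B_bound m N p))"
    using exceptional_set_exists[of \<epsilon>] assms(1) H
    by (simp only: gen_discrepancy_def gen_seq_eq_funpow)
qed

end
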